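(* Let $k\ge0$ be a fixed integer. As $n\to\infty$, the average height of the partial Łukasiewicz paths read from right to left of length $n$ ending at height $k$ (each such path being equally likely) is asymptotically equivalent to $\sqrt{\pi n}$.
   Context: A partial Łukasiewicz path read from right to left, of length $n\ge0$, is a lattice path starting at $(0,0)$, consisting of $n$ steps from $\{(1,j): j\in\mathbb{Z},\ j\le 1\}$, and never going below the $x$-axis. Its height is the maximal $y$-coordinate of its points; it ends at height $k$ if its end point has $y$-coordinate $k$. Two sequences are asymptotically equivalent if their ratio tends to $1$. *)

theory Defs
  imports Complex_Main "HOL-Library.Landau_Symbols"
begin

text \<open>
  A lattice path starting at the origin with steps of the form \<open>(1, j)\<close> is encoded by the list of
  the second components \<open>j\<close> of its steps; its points are \<open>(i, ordinate p i)\<close> for \<open>i \<le> length p\<close>.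
\<close>

definition ordinate :: "int list \<Rightarrow> nat \<Rightarrow> int" where
  "ordinate p i = sum_list (take i p)"

text \<open>Partial Lukasiewicz paths read from right to left: down-steps are unbounded.\<close>

definition is_partial_luka_rl :: "int list \<Rightarrow> bool" where
  "is_partial_luka_rl p \<longleftrightarrow> (\<forall>j\<in>set p. j \<le> 1) \<and> (\<forall>i\<le>length p. ordinate p i \<ge> 0)"

definition path_height :: "int list \<Rightarrow> int" where
  "path_height p = Max (ordinate p ` {..length p})"

definition partial_luka_rl :: "nat \<Rightarrow> nat \<Rightarrow> int list set" where
  "partial_luka_rl n k =
     {p. length p = n \<and> is_partial_luka_rl p \<and> ordinate p n = int k}"

text \<open>Finiteness makes the sum and the cardinality in the average below meaningful.\<close>

lemma finite_partial_luka_rl: "finite (partial_luka_rl n k)"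
proof (rule finite_subset)
  show "partial_luka_rl n k \<subseteq> {p. set p \<subseteq> {- int n..1} \<and> length p = n}"
  proof
    fix p assume p: "p \<in> partial_luka_rl n k"
    have len: "length p = n" and le1: "\<And>j. j \<in> set p \<Longrightarrow> j \<le> 1"
      and nonneg: "\<And>i. i \<le> n \<Longrightarrow> ordinate p i \<ge> 0"
      using p by (auto simp: partial_luka_rl_def is_partial_luka_rl_def)
    have ub: "ordinate p i \<le> int i" if "i \<le> n" for i
      using that
    proof (induction i)
      case (Suc i)
      then show ?case
        using le1[of "p ! i"] len
        by (simp add: ordinate_def take_Suc_conv_app_nth)
    qed (simp add: ordinate_def)
    have "- int n \<le> j" if "j \<in> set p" for j
    proof -
      from that obtain i where i: "i < n" "j = p ! i"
        using len by (auto simp: in_set_conv_nth)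
      have "ordinate p (Suc i) = ordinate p i + j"
        using i len by (simp add: ordinate_def take_Suc_conv_app_nth)
      then show ?thesis using ub[of i] nonneg[of "Suc i"] i by simp
    qed
    then show "p \<in> {p. set p \<subseteq> {- int n..1} \<and> length p = n}"
      using le1 len by auto
  qed
qed (rule finite_lists_length_eq, simp)

text \<open>
  The average is \<open>0\<close> by convention when there are no such paths, which happens only for \<open>n < k\<close>.
\<close>

definition average_height :: "nat \<Rightarrow> nat \<Rightarrow> real" where
  "average_height k n =
     (\<Sum>p\<in>partial_luka_rl n k. real_of_int (path_height p)) / real (card (partial_luka_rl n k))"

end

theory Submission
  imports Defs "HOL-Probability.Sinc_Integral" "HOL-Real_Asymp.Real_Asymp" "HOL-Number_Theory.Cong"
begin

text \<open>
  Divided by \<open>sqrt n\<close>, the average height is the integral over \<open>t > 0\<close> of the probability that the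
  height exceeds \<open>t * sqrt n\<close>. It therefore suffices to find the pointwise limit of this tail
  probability, a dominating integrable function, and the integral of the limit.

  \<^emph>\<open>Exact tail.\<close> Paths of length \<open>n\<close> from \<open>0\<close> to \<open>k\<close> that stay between \<open>0\<close> and \<open>h\<close> are counted by the
  reflection principle. A step \<open>j\<close> may be read as one up-step followed by \<open>1 - j\<close> down-steps, which
  turns the paths into words of \<open>n\<close> up-steps and \<open>n - k\<close> down-steps avoiding the levels \<open>-1\<close> and
  \<open>h + 2\<close>; with \<open>N = 2 * n - k\<close> and \<open>m = h + 3\<close> their number is the sum over all integers \<open>j\<close> of
  \<open>N choose (n + j * m)\<close> minus \<open>N choose (n + 1 + j * m)\<close> (\<open>card_strip_paths\<close>). This is proved by checking
  that the sum satisfies the recursion given by removing the last step, for which Pascal's rule and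
  the symmetry of the binomial coefficients suffice. The term \<open>j = 0\<close> counts all paths. The terms \<open>j\<close> and \<open>-j\<close> combine to \<open>k + 1\<close>
  consecutive second differences of a binomial row, and each of these, divided by the number of all
  paths, is an explicit quotient of binomial coefficients times a quadratic polynomial
  (\<open>height_tail_eq\<close>).

  \<^emph>\<open>Limit.\<close> If \<open>x\<close> is asymptotic to \<open>c * sqrt n\<close>, such a second difference at distance \<open>x\<close> from the
  centre tends to \<open>exp (- c^2) * (4 * c^2 - 2)\<close>, and it is bounded by a multiple of \<open>n / x^2\<close>
  (\<open>weight_tendsto\<close>, \<open>weight_bound\<close>). By Tannery's theorem the tail probability at \<open>t * sqrt n\<close> tends to
  the sum \<open>F t\<close> of \<open>exp (- (j * t)^2) * (4 * (j * t)^2 - 2)\<close> over \<open>j \<ge> 1\<close> (\<open>height_tail_tendsto\<close>); the same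
  bound, together with the trivial bound \<open>1\<close>, gives domination by a multiple of \<open>1 / (1 + t^2)\<close>.

  \<^emph>\<open>Integral.\<close> Each summand of \<open>F\<close> has the antiderivative \<open>- 2 * t * exp (- (j * t)^2)\<close>, so its
  integral over the half-line vanishes; but the summed antiderivative tends to \<open>0\<close> at infinity, while
  near \<open>0\<close> it is minus twice a Riemann sum of mesh \<open>t\<close> for the Gaussian integral and tends to
  \<open>- sqrt pi\<close>. Hence \<open>F\<close> has integral \<open>sqrt pi\<close> (\<open>limit_tail_integral\<close>).
\<close>

section \<open>Counting paths in a strip\<close>

definition strip_paths :: "nat \<Rightarrow> nat \<Rightarrow> nat \<Rightarrow> int list set" where
  "strip_paths h n k = {p \<in> partial_luka_rl n k. path_height p \<le> int h}"

lemma path_height_le_iff: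
  "path_height p \<le> c \<longleftrightarrow> (\<forall>i\<le>length p. ordinate p i \<le> c)"
  unfolding path_height_def by (subst Max_le_iff) auto

lemma ordinate_le_path_height: "i \<le> length p \<Longrightarrow> ordinate p i \<le> path_height p"
  using path_height_le_iff[of p "path_height p"] by simp

lemma strip_paths_iff:
  "p \<in> strip_paths h n k \<longleftrightarrow> length p = n \<and> (\<forall>j\<in>set p. j \<le> 1) \<and>
     (\<forall>i\<le>n. 0 \<le> ordinate p i \<and> ordinate p i \<le> int h) \<and> ordinate p n = int k"
  by (auto simp: strip_paths_def partial_luka_rl_def is_partial_luka_rl_def path_height_le_iff)

lemma ordinate_append1_le: "i \<le> length p \<Longrightarrow> ordinate (p @ [x]) i = ordinate p i"
  by (simp add: ordinate_def)

lemma ordinate_append1_Suc: "ordinate (p @ [x]) (Suc (length p)) = ordinate p (length p) + x"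
  by (simp add: ordinate_def)

lemma append1_in_strip_paths_iff:
  assumes "k \<le> h"
  shows "p @ [x] \<in> strip_paths h (Suc n) k \<longleftrightarrow>
    (\<exists>i\<in>{k - 1..h}. p \<in> strip_paths h n i \<and> x = int k - int i)"
    (is "?L \<longleftrightarrow> ?R")
proof
  assume ?L
  then have len: "length p = n" and st: "\<forall>j\<in>set p. j \<le> 1" "x \<le> 1"
    and nn: "\<And>i. i \<le> Suc n \<Longrightarrow> 0 \<le> ordinate (p @ [x]) i \<and> ordinate (p @ [x]) i \<le> int h"
    and e: "ordinate (p @ [x]) (Suc n) = int k"
    by (auto simp: strip_paths_iff)
  have nn': "0 \<le> ordinate p i \<and> ordinate p i \<le> int h" if "i \<le> n" for i
    using nn[of i] that len by (simp add: ordinate_append1_le)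
  have e': "ordinate p n + x = int k"
    using e len ordinate_append1_Suc by metis
  let ?i = "nat (ordinate p n)"
  have "p \<in> strip_paths h n ?i"
    using len st nn' nn'[of n] by (auto simp: strip_paths_iff)
  moreover have "x = int k - int ?i" "?i \<in> {k - 1..h}"
    using e' nn'[of n] st by auto
  ultimately show ?R by blast
next
  assume ?R
  then obtain i where i: "k - 1 \<le> i" "i \<le> h" "p \<in> strip_paths h n i" "x = int k - int i"
    by auto
  then have len: "length p = n" and st: "\<forall>j\<in>set p. j \<le> 1"
    and nn: "\<And>i. i \<le> n \<Longrightarrow> 0 \<le> ordinate p i \<and> ordinate p i \<le> int h"
    and e: "ordinate p n = int i"
    by (auto simp: strip_paths_iff)
  have "ordinate (p @ [x]) (Suc n) = int k"
    using ordinate_append1_Suc[of p x] len e i by simp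
  moreover have "0 \<le> ordinate (p @ [x]) l \<and> ordinate (p @ [x]) l \<le> int h" if "l \<le> Suc n" for l
    using that nn[of l] calculation assms len
    by (cases "l = Suc n") (auto simp: ordinate_append1_le)
  ultimately show ?L
    using len st i by (auto simp: strip_paths_iff)
qed

lemma finite_strip_paths: "finite (strip_paths h n k)"
  using finite_partial_luka_rl by (simp add: strip_paths_def)

lemma card_strip_paths_Suc:
  assumes "k \<le> h"
  shows "card (strip_paths h (Suc n) k) = (\<Sum>i=k-1..h. card (strip_paths h n i))"
proof -
  have "strip_paths h (Suc n) k =
      (\<Union>i\<in>{k - 1..h}. (\<lambda>p. p @ [int k - int i]) ` strip_paths h n i)" (is "?A = ?B")
  proof (intro set_eqI iffI)
    fix q assume q: "q \<in> ?A"
    then have "q \<noteq> []" by (auto simp: strip_paths_iff)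
    then obtain p x where "q = p @ [x]" by (metis rev_exhaust)
    with q append1_in_strip_paths_iff[OF assms] show "q \<in> ?B" by auto
  next
    fix q assume "q \<in> ?B"
    then show "q \<in> ?A" using append1_in_strip_paths_iff[OF assms] by auto
  qed
  also have "card \<dots> = (\<Sum>i=k-1..h. card ((\<lambda>p. p @ [int k - int i]) ` strip_paths h n i))"
    by (rule card_UN_disjoint) (auto simp: finite_strip_paths)
  also have "\<dots> = (\<Sum>i=k-1..h. card (strip_paths h n i))"
    by (intro sum.cong card_image inj_onI) auto
  finally show ?thesis .
qed

lemma ordinate_le_index:
  assumes "\<forall>j\<in>set p. j \<le> 1" "i \<le> length p"
  shows "ordinate p i \<le> int i"
  using assms(2)
proof (induction i)
  case (Suc i)
  then have "p ! i \<le> 1" using assms(1) by simp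
  with Suc show ?case by (simp add: ordinate_def take_Suc_conv_app_nth)
qed (simp add: ordinate_def)

lemma strip_paths_empty:
  assumes "n < k"
  shows "strip_paths h n k = {}"
proof -
  have False if "p \<in> strip_paths h n k" for p
    using that ordinate_le_index[of p n] assms by (auto simp: strip_paths_iff)
  then show ?thesis by blast
qed

lemma strip_paths_high:
  assumes "n \<le> h"
  shows "strip_paths h n k = partial_luka_rl n k"
proof -
  have "path_height p \<le> int h" if "p \<in> partial_luka_rl n k" for p
    using that ordinate_le_index[of p] assms
    by (force simp: path_height_le_iff partial_luka_rl_def is_partial_luka_rl_def)
  then show ?thesis by (auto simp: strip_paths_def)
qed

lemma strip_paths_0: "strip_paths h 0 k = (if k = 0 then {[]} else {})"
  by (auto simp: strip_paths_iff ordinate_def)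

section \<open>Binomial coefficients summed over a residue class\<close>

text \<open>
  Writing a bilateral sum of \<open>N choose (r + j * m)\<close> over all integers \<open>j\<close> as a sum over one residue
  class makes it a finite sum whose periodicity in \<open>r\<close> is immediate; together with Pascal's rule and
  the symmetry of binomial coefficients this is all that the reflection principle needs.
\<close>
definition wrapped_binomial :: "nat \<Rightarrow> nat \<Rightarrow> int \<Rightarrow> int" where
  "wrapped_binomial m N r = (\<Sum>i | i \<le> N \<and> [int i = r] (mod int m). int (N choose i))"

lemma wrapped_binomial_cong:
  assumes "[r = s] (mod int m)"
  shows "wrapped_binomial m N r = wrapped_binomial m N s"
proof -
  have "[int i = r] (mod int m) \<longleftrightarrow> [int i = s] (mod int m)" for i
    using assms by (meson cong_sym cong_trans)
  then show ?thesis by (simp add: wrapped_binomial_def)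
qed

lemma wrapped_binomial_symmetric:
  "wrapped_binomial m N (int N - r) = wrapped_binomial m N r"
  unfolding wrapped_binomial_def
proof (rule sum.reindex_bij_witness[of _ "\<lambda>i. N - i" "\<lambda>i. N - i"])
  fix i assume "i \<in> {i. i \<le> N \<and> [int i = int N - r] (mod int m)}"
  then show "N - i \<in> {i. i \<le> N \<and> [int i = r] (mod int m)}"
    by (auto simp: cong_iff_dvd_diff of_nat_diff) (metis dvd_minus_iff minus_diff_eq diff_diff_eq2 add.commute diff_diff_eq)
next
  fix i assume "i \<in> {i. i \<le> N \<and> [int i = r] (mod int m)}"
  then show "N - i \<in> {i. i \<le> N \<and> [int i = int N - r] (mod int m)}"
    by (auto simp: cong_iff_dvd_diff of_nat_diff) (metis dvd_minus_iff minus_diff_eq)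
qed (auto simp: binomial_symmetric[symmetric])

lemma wrapped_binomial_eq_sum:
  "wrapped_binomial m N r = (\<Sum>i\<le>N. if [int i = r] (mod int m) then int (N choose i) else 0)"
  unfolding wrapped_binomial_def by (subst sum.If_cases) (auto intro!: sum.cong)

lemma wrapped_binomial_Pascal:
  "wrapped_binomial m (Suc N) (r + 1) = wrapped_binomial m N r + wrapped_binomial m N (r + 1)"
proof -
  have shift: "[int (Suc i) = r + 1] (mod int m) \<longleftrightarrow> [int i = r] (mod int m)" for i
    by (simp add: cong_iff_dvd_diff algebra_simps)
  let ?g = "\<lambda>N i. if [int i = r + 1] (mod int m) then int (N choose i) else 0"
  have "wrapped_binomial m (Suc N) (r + 1) = ?g (Suc N) 0 + (\<Sum>i\<le>N. ?g (Suc N) (Suc i))"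
    unfolding wrapped_binomial_eq_sum by (rule sum.atMost_Suc_shift)
  also have "(\<Sum>i\<le>N. ?g (Suc N) (Suc i)) =
      (\<Sum>i\<le>N. if [int i = r] (mod int m) then int (N choose i) else 0) + (\<Sum>i\<le>N. ?g N (Suc i))"
    by (simp only: sum.distrib[symmetric] shift) (auto intro!: sum.cong)
  also have "?g (Suc N) 0 = ?g N 0" by simp
  also have "?g N 0 + ((\<Sum>i\<le>N. if [int i = r] (mod int m) then int (N choose i) else 0) + (\<Sum>i\<le>N. ?g N (Suc i)))
     = wrapped_binomial m N r + (\<Sum>i\<le>Suc N. ?g N i)"
    by (subst sum.atMost_Suc_shift) (simp add: wrapped_binomial_eq_sum)
  also have "(\<Sum>i\<le>Suc N. ?g N i) = wrapped_binomial m N (r + 1)"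
    by (simp add: wrapped_binomial_eq_sum)
  finally show ?thesis .
qed

lemma wrapped_binomial_single:
  assumes "r \<le> N" "N < m"
  shows "wrapped_binomial m N (int r) = int (N choose r)"
proof -
  have *: "{i. i \<le> N \<and> [int i = int r] (mod int m)} = {r}"
    using assms by (auto simp: cong_def)
  show ?thesis unfolding wrapped_binomial_def * by simp
qed

lemma wrapped_binomial_zero:
  assumes "N < r" "r < m"
  shows "wrapped_binomial m N (int r) = 0"
proof -
  have *: "{i. i \<le> N \<and> [int i = int r] (mod int m)} = {}"
    using assms by (auto simp: cong_def)
  show ?thesis unfolding wrapped_binomial_def * by simp
qed

section \<open>The reflection formula\<close>

text \<open>
  With \<open>m = h + 3\<close> this is the number of words with \<open>n\<close> up-steps and \<open>n - k\<close> down-steps that avoid the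
  levels \<open>-1\<close> and \<open>h + 2\<close>: the composition of the two reflections moves the end point by \<open>2 * m\<close> levels,
  that is, it changes the number of up-steps by \<open>m\<close>.
\<close>
definition reflection_count :: "nat \<Rightarrow> nat \<Rightarrow> nat \<Rightarrow> int" where
  "reflection_count m n k = wrapped_binomial m (2*n-k) (int n) - wrapped_binomial m (2*n-k) (int n + 1)"

text \<open>
  An end point on one of the two forbidden levels is fixed, up to period, by a reflection, so the two
  sums cancel. For \<open>k = h + 2\<close> and \<open>m = h + 3\<close> the congruence holds because \<open>2 * n - k = 2 * n + 1 - m\<close>.
\<close>
lemma reflection_count_eq_0:
  assumes "[int (2*n-k) = 2 * int n + 1] (mod int m)"
  shows "reflection_count m n k = 0"
proof -
  have "wrapped_binomial m (2*n-k) (int n) = wrapped_binomial m (2*n-k) (int (2*n-k) - int n)"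
    by (simp add: wrapped_binomial_symmetric)
  also have "\<dots> = wrapped_binomial m (2*n-k) (int n + 1)"
    by (rule wrapped_binomial_cong) (use assms in \<open>simp add: cong_iff_dvd_diff algebra_simps\<close>)
  finally show ?thesis by (simp add: reflection_count_def)
qed

text \<open>
  In terms of words with \<open>n + 1\<close> up-steps ending at level \<open>i + 1\<close>: the last letter is an up-step from
  level \<open>i\<close> or a down-step from level \<open>i + 2\<close>.
\<close>
lemma reflection_count_step:
  assumes "i \<le> 2 * n"
  shows "reflection_count m n i = reflection_count m (Suc n) (Suc i) - reflection_count m (Suc n) (Suc (Suc i))"
proof -
  have "2 * Suc n - Suc i = Suc (2 * n - i)" "2 * Suc n - Suc (Suc i) = 2 * n - i"
    using assms by auto
  then show ?thesis
    using wrapped_binomial_Pascal[of m "2*n-i" "int n"] wrapped_binomial_Pascal[of m "2*n-i" "int n + 1"]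
    by (simp add: reflection_count_def algebra_simps)
qed

text \<open>
  A word ending at \<open>0\<close> cannot end with an up-step, since level \<open>-1\<close> is forbidden.
\<close>
lemma reflection_count_0_eq_1: "reflection_count m (Suc n) 0 = reflection_count m (Suc n) 1"
proof -
  have "wrapped_binomial m (Suc (2*n)) (int n) = wrapped_binomial m (Suc (2*n)) (int n + 1)"
    using wrapped_binomial_symmetric[of m "Suc (2*n)" "int n + 1"] by simp
  then show ?thesis
    using wrapped_binomial_Pascal[of m "Suc (2*n)" "int n"] wrapped_binomial_Pascal[of m "Suc (2*n)" "int n + 1"]
    by (simp add: reflection_count_def algebra_simps)
qed

lemma sum_reflection_count:
  assumes "a \<le> Suc b" "b \<le> 2 * n"
  shows "(\<Sum>i=a..b. reflection_count m n i) =
     reflection_count m (Suc n) (Suc a) - reflection_count m (Suc n) (Suc (Suc b))"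
proof -
  have "(\<Sum>i=a..b. reflection_count m n i) =
      (\<Sum>i=a..b. reflection_count m (Suc n) (Suc i) - reflection_count m (Suc n) (Suc (Suc i)))"
    using assms by (intro sum.cong) (auto intro!: reflection_count_step)
  also have "\<dots> = - (\<Sum>i=a..b. reflection_count m (Suc n) (Suc (Suc i)) - reflection_count m (Suc n) (Suc i))"
    by (simp add: sum_negf[symmetric])
  also have "(\<Sum>i=a..b. reflection_count m (Suc n) (Suc (Suc i)) - reflection_count m (Suc n) (Suc i))
     = reflection_count m (Suc n) (Suc (Suc b)) - reflection_count m (Suc n) (Suc a)"
    using sum_Suc_diff[of a b "\<lambda>i. reflection_count m (Suc n) (Suc i)"] assms by simp
  finally show ?thesis by simp
qed

text \<open>
  Removing the last step of a path gives a sum over the levels \<open>k - 1, ..., h\<close>; on the side of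
  \<open>reflection_count\<close> the same sum telescopes, and its upper end vanishes. The levels above \<open>n\<close> cannot be
  reached and are cut off first, since the subtraction in \<open>2 * n - i\<close> truncates for large \<open>i\<close>.
\<close>
lemma card_strip_paths:
  assumes "k \<le> h" "k \<le> n"
  shows "int (card (strip_paths h n k)) = reflection_count (h + 3) n k"
  using assms
proof (induction n arbitrary: k)
  case 0
  then show ?case
    using wrapped_binomial_single[of 0 0 "h+3"] wrapped_binomial_zero[of 0 1 "h+3"]
    by (simp add: strip_paths_0 reflection_count_def)
next
  case (Suc n)
  let ?m = "h + 3" and ?b = "min h n"
  have "int (card (strip_paths h (Suc n) k)) = (\<Sum>i=k-1..h. int (card (strip_paths h n i)))"
    using Suc.prems by (simp add: card_strip_paths_Suc)
  also have "\<dots> = (\<Sum>i=k-1..?b. int (card (strip_paths h n i)))"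
    by (rule sum.mono_neutral_right) (auto simp: strip_paths_empty)
  also have "\<dots> = (\<Sum>i=k-1..?b. reflection_count ?m n i)"
    by (intro sum.cong) (auto simp: Suc.IH)
  also have "\<dots> = reflection_count ?m (Suc n) (Suc (k-1)) - reflection_count ?m (Suc n) (Suc (Suc ?b))"
    using Suc.prems by (intro sum_reflection_count) auto
  \<comment> \<open>Either \<open>h + 2\<close> is the upper forbidden level, or the level \<open>n + 2\<close> is out of reach and
    all binomial coefficients involved are \<open>0\<close>.\<close>
  also have "reflection_count ?m (Suc n) (Suc (Suc ?b)) = 0"
  proof (cases "h \<le> n")
    case True
    then have "int (2 * Suc n - Suc (Suc h)) - (2 * int (Suc n) + 1) = - int ?m" by simp
    then have "[int (2 * Suc n - Suc (Suc h)) = 2 * int (Suc n) + 1] (mod int ?m)"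
      by (simp only: cong_iff_dvd_diff dvd_minus_iff dvd_refl)
    then show ?thesis using True reflection_count_eq_0 by simp
  next
    case False
    then show ?thesis
      using wrapped_binomial_zero[of n "Suc n" ?m] wrapped_binomial_zero[of n "Suc (Suc n)" ?m]
      by (simp add: reflection_count_def algebra_simps)
  qed
  also have "reflection_count ?m (Suc n) (Suc (k-1)) = reflection_count ?m (Suc n) k"
    by (cases k) (auto simp: reflection_count_0_eq_1)
  finally show ?case by simp
qed

text \<open>
  A strip higher than all paths of length \<open>n\<close> imposes no condition; for so large a period only one
  binomial coefficient is left in each residue class.
\<close>
lemma card_partial_luka_rl:
  assumes "k \<le> n"
  shows "int (card (partial_luka_rl n k)) = int ((2*n-k) choose n) - int ((2*n-k) choose (Suc n))"
proof -
  let ?h = "2*n"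
  have "int (card (partial_luka_rl n k)) = reflection_count (?h + 3) n k"
    using card_strip_paths[of k ?h n] assms strip_paths_high[of n ?h k] by simp
  moreover have "wrapped_binomial (?h+3) (2*n-k) (int (Suc n)) = int ((2*n-k) choose (Suc n))"
    using wrapped_binomial_single[of "Suc n" "2*n-k" "?h+3"] wrapped_binomial_zero[of "2*n-k" "Suc n" "?h+3"]
    by (cases "Suc n \<le> 2*n-k") (auto simp: binomial_eq_0)
  ultimately show ?thesis
    using wrapped_binomial_single[of n "2*n-k" "?h+3"] assms
    by (simp add: reflection_count_def algebra_simps)
qed

section \<open>The exact tail of the height distribution\<close>

lemma sum_residue_class_above:
  assumes "m > 0" "N \<le> J"
  shows "(\<Sum>i | i \<le> N \<and> r < i \<and> [int i = int r] (mod int m). int (N choose i)) =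
         (\<Sum>j=1..J. int (N choose (r + m * j)))"
proof -
  let ?I = "{i. i \<le> N \<and> r < i \<and> [int i = int r] (mod int m)}"
  let ?K = "{j\<in>{1..J}. r + m * j \<le> N}"
  have I: "?I = (\<lambda>j. r + m * j) ` ?K"
  proof (intro set_eqI iffI)
    fix i assume i: "i \<in> ?I"
    then have "[i = r] (mod m)" by (simp add: cong_int_iff)
    with i have "m dvd i - r" by (simp add: cong_altdef_nat)
    then obtain q where "i - r = m * q" by (rule dvdE)
    with i have "i = m * q + r" by auto
    then have q: "i = q * m + r" by (simp only: mult.commute)
    have "q \<le> q * m" using assms by simp
    from i q have "q \<noteq> 0" by auto
    moreover have "q \<le> J"
    proof -
      have "q * m \<le> N" using i q by simp
      with \<open>q \<le> q * m\<close> assms(2) show ?thesis by linarith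
    qed
    ultimately show "i \<in> (\<lambda>j. r + m * j) ` ?K"
      using i q by (intro image_eqI[of _ _ q]) (auto simp: mult.commute)
  next
    fix i assume "i \<in> (\<lambda>j. r + m * j) ` ?K"
    then show "i \<in> ?I" using assms by (auto simp: cong_iff_dvd_diff)
  qed
  have "(\<Sum>i\<in>?I. int (N choose i)) = (\<Sum>j\<in>?K. int (N choose (r + m * j)))"
    unfolding I using assms by (subst sum.reindex) (auto simp: inj_on_def)
  also have "\<dots> = (\<Sum>j=1..J. int (N choose (r + m * j)))"
    by (rule sum.mono_neutral_left) (auto simp: binomial_eq_0)
  finally show ?thesis .
qed

text \<open>
  The indices below \<open>r\<close> are reflected to indices above \<open>N - r\<close>. In this form both tails are indexed by
  positive multiples of \<open>m\<close> and may be extended to any \<open>J \<ge> N\<close>, the additional terms being \<open>0\<close>.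
\<close>
lemma wrapped_binomial_expand:
  assumes "m > 0" "N \<le> J" "r \<le> N"
  shows "wrapped_binomial m N (int r) = int (N choose r) +
     (\<Sum>j=1..J. int (N choose (r + m * j))) + (\<Sum>j=1..J. int (N choose (N - r + m * j)))"
proof -
  let ?C = "\<lambda>i. [int i = int r] (mod int m)"
  have split: "{i. i \<le> N \<and> ?C i} = insert r ({i. i \<le> N \<and> r < i \<and> ?C i} \<union> {i. i < r \<and> ?C i})"
    using assms by auto
  have "(\<Sum>i | i < r \<and> ?C i. int (N choose i)) =
        (\<Sum>i | i \<le> N \<and> N - r < i \<and> [int i = int (N - r)] (mod int m). int (N choose i))"
  proof (rule sum.reindex_bij_witness[of _ "\<lambda>i. N - i" "\<lambda>i. N - i"])
    fix i assume i: "i \<in> {i. i < r \<and> ?C i}"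
    then have "[int r = int i] (mod int m)" by (simp add: cong_sym)
    with i show "N - i \<in> {i. i \<le> N \<and> N - r < i \<and> [int i = int (N - r)] (mod int m)}"
      using assms by (auto simp: of_nat_diff cong_iff_dvd_diff)
  next
    fix i assume i: "i \<in> {i. i \<le> N \<and> N - r < i \<and> [int i = int (N - r)] (mod int m)}"
    then have "[int (N - r) = int i] (mod int m)" by (simp add: cong_sym)
    with i show "N - i \<in> {i. i < r \<and> ?C i}"
      using assms by (auto simp: of_nat_diff cong_iff_dvd_diff algebra_simps)
  qed (use assms in \<open>auto simp: binomial_symmetric[symmetric]\<close>)
  also have "\<dots> = (\<Sum>j=1..J. int (N choose (N - r + m * j)))"
    using assms by (intro sum_residue_class_above)
  finally have low: "(\<Sum>i | i < r \<and> ?C i. int (N choose i)) = \<dots>" .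
  have "wrapped_binomial m N (int r) = int (N choose r) +
     ((\<Sum>i | i \<le> N \<and> r < i \<and> ?C i. int (N choose i)) + (\<Sum>i | i < r \<and> ?C i. int (N choose i)))"
    unfolding wrapped_binomial_def split
    by (subst sum.insert; (subst sum.union_disjoint)?) auto
  then show ?thesis
    using sum_residue_class_above[OF assms(1,2), of r] low by simp
qed

lemma binomial_absorb_bottom:
  "real (Suc N choose Suc i) * real (Suc i) = real (Suc N) * real (N choose i)"
  by (metis Suc_times_binomial_eq of_nat_mult)

lemma binomial_absorb_top:
  "real (Suc N choose i) * (real (Suc N) - real i) = real (Suc N) * real (N choose i)"
proof (cases "i \<le> Suc N")
  case True
  then show ?thesis
    using binomial_absorb_comp[of "Suc N" i]
    by (metis diff_Suc_1 mult.commute of_nat_diff of_nat_mult)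
qed (simp add: binomial_eq_0)

lemma binomial_absorb_both:
  "real (Suc (Suc N) choose Suc i) * real (Suc i) * (real (Suc N) - real i)
     = real (Suc (Suc N)) * real (Suc N) * real (N choose i)"
  using binomial_absorb_bottom[of "Suc N" i] binomial_absorb_top[of N i] by (metis mult.assoc)

text \<open>
  Over the common denominator \<open>(i + 2)! * (N - i)!\<close>, with \<open>a = i + 2\<close> and \<open>b = N - i\<close>, the numerators add
  up to \<open>a * (a - 1) - 2 * a * b + b * (b - 1) = (a - b)^2 - (a + b)\<close>.
\<close>
lemma binomial_second_difference:
  "real (N choose Suc (Suc i)) - 2 * real (N choose Suc i) + real (N choose i) =
     real (Suc (Suc N) choose Suc (Suc i)) * ((2 * real (i + 2) - real (N + 2))\<^sup>2 - real (N + 2))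
       / (real (N + 2) * real (N + 1))"
proof -
  let ?A = "real (Suc (Suc N) choose Suc (Suc i))" and ?n = "real N" and ?i = "real i"
  have 0: "?A * (?i + 2) * (?i + 1) = (?n + 2) * (?n + 1) * real (N choose i)"
    using binomial_absorb_bottom[of "Suc N" "Suc i"] binomial_absorb_bottom[of N i]
    by (simp add: algebra_simps del: binomial_Suc_Suc)
  have 1: "?A * (?i + 2) * (?n - ?i) = (?n + 2) * (?n + 1) * real (N choose Suc i)"
    using binomial_absorb_both[of N "Suc i"] by (simp add: algebra_simps del: binomial_Suc_Suc)
  have 2: "?A * (?n - ?i) * (?n - ?i - 1) = (?n + 2) * (?n + 1) * real (N choose Suc (Suc i))"
    using binomial_absorb_top[of "Suc N" "Suc (Suc i)"] binomial_absorb_top[of N "Suc (Suc i)"]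
    by (simp add: algebra_simps del: binomial_Suc_Suc)
  have eq: "(real (N choose Suc (Suc i)) - 2 * real (N choose Suc i) + real (N choose i)) * ((?n + 2) * (?n + 1))
     = ?A * ((2 * (?i + 2) - (?n + 2))\<^sup>2 - (?n + 2))"
    using 0 1 2 by algebra
  have cast: "real (N + 2) = ?n + 2" "real (N + 1) = ?n + 1" "real (i + 2) = ?i + 2" by simp_all
  have "(?n + 2) * (?n + 1) \<noteq> 0"
    by (simp add: add_nonneg_eq_0_iff)
  then show ?thesis
    unfolding cast using eq by (rule eq_divide_imp)
qed

text \<open>
  Up to the factor \<open>k + 1\<close>, this is the second difference of the binomial row \<open>2 * n - k\<close> at distance \<open>x\<close>
  from the entry \<open>n\<close>, divided by the number of paths of length \<open>n\<close> ending at \<open>k\<close>; see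
  \<open>weight_eq_second_difference\<close>. The form chosen here shows the Gaussian factor and the quadratic one.
\<close>
definition weight :: "nat \<Rightarrow> nat \<Rightarrow> nat \<Rightarrow> real" where
  "weight k n x = real ((2*n-k+2) choose (n+1+x)) / real ((2*n-k+2) choose (n+1))
     * ((2 * real x + real k)\<^sup>2 - real (2*n-k+2)) / real (n+1-k)"

definition height_tail :: "nat \<Rightarrow> nat \<Rightarrow> nat \<Rightarrow> real" where
  "height_tail k n h = real (card {p \<in> partial_luka_rl n k. int h < path_height p})
     / real (card (partial_luka_rl n k))"

lemma real_card_partial_luka_rl:
  assumes "k \<le> n"
  shows "real (card (partial_luka_rl n k)) = real (k + 1) / real (n + 1) * real ((2*n-k) choose n)"
proof -
  have "real (card (partial_luka_rl n k)) = real_of_int (int (card (partial_luka_rl n k)))"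
    by simp
  also have "\<dots> = real ((2*n-k) choose n) - real ((2*n-k) choose Suc n)"
    by (subst card_partial_luka_rl[OF assms]) simp
  finally have c: "real (card (partial_luka_rl n k)) = \<dots>" .
  have "real ((2*n-k) choose Suc n) * real (Suc n) = real ((2*n-k) choose n) * real (n - k)"
  proof -
    have "((2*n-k) choose Suc n) * Suc n = ((2*n-k) choose n) * (2*n-k-n)"
      using binomial_absorption[of n "2*n-k"] binomial_absorb_comp[of "2*n-k" n]
      by (simp add: mult.commute)
    moreover have "2*n-k-n = n - k" by simp
    ultimately show ?thesis by (metis of_nat_mult)
  qed
  then show ?thesis
    using assms unfolding c by (simp add: field_simps of_nat_diff)
qed

lemma weight_eq_second_difference:
  assumes "k < n" "0 < n + x"
  shows "weight k n x / real (k + 1) =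
     (real ((2*n-k) choose (n+1+x)) - 2 * real ((2*n-k) choose (n+x)) + real ((2*n-k) choose (n+x-1)))
       / real (card (partial_luka_rl n k))"
proof -
  define N where "N = 2*n-k"
  define i where "i = n + x - 1"
  have i: "n + 1 + x = Suc (Suc i)" "n + x = Suc i" "n + x - 1 = i" using assms by (auto simp: i_def)
  have rN: "real N = 2 * real n - real k" using assms by (simp add: N_def of_nat_diff)
  have ri: "real i = real n + real x - 1" using i(2) by linarith
  have C: "real (Suc (Suc N) choose Suc n) * real (n + 1) * real (n + 1 - k)
     = real (N + 2) * real (N + 1) * real (N choose n)"
  proof -
    have "real (n + 1 - k) = real (Suc N) - real n" "real (n + 1) = real (Suc n)"
      "real (N + 2) = real (Suc (Suc N))" "real (N + 1) = real (Suc N)"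
      using assms rN by (auto simp: of_nat_diff)
    then show ?thesis using binomial_absorb_both[of N n] by (simp only:)
  qed
  have pos: "real (Suc (Suc N) choose Suc n) > 0" "real (N choose n) > 0" "real (n + 1 - k) > 0"
     "real (N + 2) * real (N + 1) > 0"
    using assms by (auto simp: N_def simp del: binomial_Suc_Suc of_nat_add of_nat_mult of_nat_Suc)
  have sq: "(2 * real (i + 2) - real (N + 2))\<^sup>2 = (2 * real x + real k)\<^sup>2"
    using rN ri by simp
  define Y where "Y = (2 * real x + real k)\<^sup>2 - real (N + 2)"
  define B where "B = real (Suc (Suc N) choose Suc (Suc i))"
  define D where "D = real (Suc (Suc N) choose Suc n)"
  define E where "E = real (N choose n)"
  have "weight k n x / real (k + 1) = B / D * Y / real (n+1-k) / real (k+1)"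
    unfolding weight_def i(1) B_def D_def Y_def by (simp add: N_def)
  also have "\<dots> = B * Y / (real (N + 2) * real (N + 1)) / (real (k + 1) / real (n + 1) * E)"
  proof -
    have D: "D = real (N + 2) * real (N + 1) * E / (real (n + 1) * real (n + 1 - k))"
      using C pos unfolding D_def E_def by (simp add: eq_divide_eq mult.assoc del: of_nat_add of_nat_Suc binomial_Suc_Suc)
    have "E > 0" "real (k+1) > 0" "real (n+1) > 0" using pos E_def by auto
    then show ?thesis unfolding D using pos(3,4) by (simp add: field_simps del: of_nat_add of_nat_Suc)
  qed
  also have "\<dots> = (real (N choose Suc (Suc i)) - 2 * real (N choose Suc i) + real (N choose i))
       / real (card (partial_luka_rl n k))"
  proof -
    have "k \<le> n" using assms by simp
    show ?thesis
      unfolding real_card_partial_luka_rl[OF \<open>k \<le> n\<close>]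
        binomial_second_difference[of N i, unfolded sq, unfolded N_def] Y_def B_def E_def N_def by (rule refl)
  qed
  finally show ?thesis unfolding i(1,3) unfolding i(2) N_def .
qed

lemma card_above_strip:
  "real (card {p \<in> partial_luka_rl n k. int h < path_height p}) =
    real (card (partial_luka_rl n k)) - real (card (strip_paths h n k))"
proof -
  have "card (partial_luka_rl n k) =
     card ({p \<in> partial_luka_rl n k. int h < path_height p} \<union> strip_paths h n k)"
    by (rule arg_cong[of _ _ card]) (auto simp: strip_paths_def)
  also have "\<dots> = card {p \<in> partial_luka_rl n k. int h < path_height p} + card (strip_paths h n k)"
    by (rule card_Un_disjoint)
       (auto simp: finite_partial_luka_rl finite_strip_paths, auto simp: strip_paths_def)
  finally show ?thesis by simp
qed

text \<open>
  With \<open>D i\<close> the first difference of the binomial row at \<open>i\<close> and \<open>M = m * j\<close>, the terms of the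
  reflection formula for \<open>j\<close> and \<open>-j\<close> contribute \<open>D (n + M) - D (n + M - k - 1)\<close> to the tail, by the
  symmetry of the row; this telescopes into \<open>k + 1\<close> second differences.
\<close>
lemma height_tail_eq:
  assumes "k < n" "k \<le> h" "2 * n \<le> J"
  shows "height_tail k n h = (\<Sum>l\<le>k. \<Sum>j=1..J. weight k n ((h + 3) * j - l)) / real (k + 1)"
proof -
  define N where "N = 2*n-k"
  define T where "T = real (card (partial_luka_rl n k))"
  define D where "D i = real (N choose Suc i) - real (N choose i)" for i
  let ?m = "h + 3"
  have N: "N \<le> J" "n \<le> N" "n + 1 \<le> N" "N - n = n - k" "N - (n + 1) = n - k - 1"
    using assms by (auto simp: N_def)
  have A: "real (card (strip_paths h n k)) = real_of_int (reflection_count ?m n k)"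
    using card_strip_paths[of k h n] assms by (metis less_imp_le of_int_of_nat_eq)
  have T: "T = real (N choose n) - real (N choose (n + 1))"
  proof -
    have "T = real_of_int (int (card (partial_luka_rl n k)))" by (simp add: T_def)
    then show ?thesis using card_partial_luka_rl[of k n] assms by (simp add: N_def)
  qed
  have w1: "wrapped_binomial ?m N (int n) = int (N choose n) +
     (\<Sum>j=1..J. int (N choose (n + ?m * j))) + (\<Sum>j=1..J. int (N choose (n - k + ?m * j)))"
    using wrapped_binomial_expand[of ?m N J n] N by simp
  have w2: "wrapped_binomial ?m N (int n + 1) = int (N choose (n + 1)) +
     (\<Sum>j=1..J. int (N choose (n + 1 + ?m * j))) + (\<Sum>j=1..J. int (N choose (n - k - 1 + ?m * j)))"
    using wrapped_binomial_expand[of ?m N J "n+1"] unfolding N(5) using N(1,3) by (simp add: add.commute)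
  have "T - real (card (strip_paths h n k)) =
     (\<Sum>j=1..J. D (n + ?m * j) - D (n + ?m * j - Suc k))"
  proof -
    have *: "D (n + ?m * j) - D (n + ?m * j - Suc k) =
       real (N choose (n + 1 + ?m * j)) + real (N choose (n - k - 1 + ?m * j)) 
         - real (N choose (n + ?m * j)) - real (N choose (n - k + ?m * j))" for j
    proof -
      have e: "Suc (n + ?m * j) = n + 1 + ?m * j" "n + ?m * j - Suc k = n - k - 1 + ?m * j"
        "Suc (n - k - 1 + ?m * j) = n - k + ?m * j" using assms by auto
      show ?thesis unfolding D_def e by linarith
    qed
    show ?thesis unfolding A T * reflection_count_def N_def[symmetric] w1 w2
      by (simp only: sum.distrib sum_subtractf of_int_add of_int_diff of_int_sum of_int_of_nat_eq)
  qed
  also have "\<dots> = (\<Sum>j=1..J. \<Sum>l\<le>k. weight k n (?m * j - l) / real (k + 1) * T)"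
  proof (intro sum.cong refl)
    fix j assume "j \<in> {1..J}"
    then have j: "?m \<le> ?m * j" by simp
    have "D (n + ?m * j) - D (n + ?m * j - Suc k) =
       (\<Sum>l\<le>k. D (n + ?m * j - l) - D (n + ?m * j - Suc l))"
      using sum_telescope[of "\<lambda>l. D (n + ?m * j - l)" k, symmetric] by (simp only: diff_zero)
    also have "\<dots> = (\<Sum>l\<le>k. weight k n (?m * j - l) / real (k + 1) * T)"
    proof (intro sum.cong refl)
      fix l assume "l \<in> {..k}"
      then have "l \<le> k" by simp
      then have l: "l < ?m * j" using assms(2) j by linarith
      define x where "x = ?m * j - l"
      have x: "x > 0" "n + ?m * j - l = n + x" "n + ?m * j - Suc l = n + x - 1" "Suc (n + x - 1) = n + x"
        using l by (auto simp: x_def)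
      have "T > 0" unfolding T_def
        using real_card_partial_luka_rl[of k n] assms by simp
      then show "D (n + ?m * j - l) - D (n + ?m * j - Suc l) = weight k n (?m * j - l) / real (k + 1) * T"
        using weight_eq_second_difference[of k n x] assms x
        unfolding x_def[symmetric] x(2,3) D_def x(4) N_def[symmetric] T_def[symmetric] by simp
    qed
    finally show "D (n + ?m * j) - D (n + ?m * j - Suc k) = \<dots>" .
  qed
  also have "\<dots> = (\<Sum>l\<le>k. \<Sum>j=1..J. weight k n (?m * j - l)) / real (k + 1) * T"
    by (subst sum.swap) (simp add: sum_divide_distrib sum_distrib_right)
  finally have "T - real (card (strip_paths h n k)) = \<dots>" .
  moreover have "T > 0" unfolding T_def
    using real_card_partial_luka_rl[of k n] assms by simp
  ultimately show ?thesis
    unfolding height_tail_def card_above_strip T_def[symmetric] by simp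
qed

section \<open>Gaussian asymptotics of the weights\<close>

lemma binomial_ratio_step:
  assumes "x < q"
  shows "real ((p+q) choose (p + Suc x)) =
    real ((p+q) choose (p+x)) * ((real q - real x) / (real p + real x + 1))"
proof -
  have "Suc (p+x) * ((p+q) choose Suc (p+x)) = (p+q-(p+x)) * ((p+q) choose (p+x))"
    by (metis binomial_absorb_comp binomial_absorption)
  then have "real (Suc (p+x)) * real ((p+q) choose Suc (p+x)) = real (q-x) * real ((p+q) choose (p+x))"
    by (metis add_diff_cancel_left of_nat_mult)
  then show ?thesis using assms by (simp add: field_simps of_nat_diff)
qed

text \<open>
  The quotient of consecutive coefficients is at most \<open>1 - (2 * x + 1) / (p + X)\<close>, which is at most
  \<open>exp (- (2 * x + 1) / (p + X))\<close>; the odd numbers \<open>2 * x + 1\<close> add up to a square. The free parameter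
  \<open>X\<close> bounds the number of steps taken: \<open>X = x\<close> is sharp enough for the limit, and \<open>X = p\<close> gives a uniform
  bound.
\<close>
lemma binomial_ratio_upper:
  assumes "q \<le> p" "x \<le> X" "0 < p"
  shows "real ((p+q) choose (p+x)) \<le> real ((p+q) choose p) * exp (- (real x)\<^sup>2 / (real p + real X))"
  using assms(2)
proof (induction x)
  case (Suc x)
  show ?case
  proof (cases "x < q")
    case True
    let ?d = "real p + real X"
    have d: "?d > 0" "real p + real x + 1 \<le> ?d" using assms Suc.prems by auto
    have "(real q - real x) / (real p + real x + 1) \<le> (real p - real x) / (real p + real x + 1)"
      using assms by (intro divide_right_mono) auto
    also have "\<dots> = 1 - (2 * real x + 1) / (real p + real x + 1)"
      by (simp add: field_simps)
    also have "\<dots> \<le> 1 + - (2 * real x + 1) / ?d"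
    proof -
      have "(2 * real x + 1) / ?d \<le> (2 * real x + 1) / (real p + real x + 1)"
        using d by (intro divide_left_mono) auto
      then show ?thesis by (simp only: minus_divide_left[symmetric])
    qed
    also have "\<dots> \<le> exp (- (2 * real x + 1) / ?d)"
      by (rule exp_ge_add_one_self)
    finally have step: "(real q - real x) / (real p + real x + 1) \<le> exp (- (2 * real x + 1) / ?d)" .
    have "real ((p+q) choose (p + Suc x)) =
       real ((p+q) choose (p+x)) * ((real q - real x) / (real p + real x + 1))"
      by (rule binomial_ratio_step[OF True])
    also have "\<dots> \<le> (real ((p+q) choose p) * exp (- (real x)\<^sup>2 / ?d)) * exp (- (2 * real x + 1) / ?d)"
      using Suc True by (intro mult_mono step) auto
    also have "\<dots> = real ((p+q) choose p) * exp (- (real (Suc x))\<^sup>2 / ?d)"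
      by (simp add: mult.assoc exp_add[symmetric] add_divide_distrib[symmetric] power2_eq_square algebra_simps)
    finally show ?thesis .
  qed (simp add: binomial_eq_0)
qed simp

text \<open>
  As for the upper bound, with the inverse quotient \<open>1 + (p - q + 2 * x + 1) / (q - x)\<close> estimated from
  above by an exponential.
\<close>
lemma binomial_ratio_lower:
  assumes "q \<le> p" "x \<le> X" "X < q"
  shows "real ((p+q) choose p) * exp (- ((real x)\<^sup>2 + (real p - real q) * real x) / (real q - real X))
     \<le> real ((p+q) choose (p+x))"
  using assms(2)
proof (induction x)
  case (Suc x)
  let ?d = "real q - real X" and ?e = "real p - real q + (2 * real x + 1)"
  have d: "?d > 0" "?d \<le> real q - real x" and x: "x < q" using assms Suc.prems by auto
  have "(real p + real x + 1) / (real q - real x) = 1 + ?e / (real q - real x)"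
    using d by (simp add: field_simps)
  also have "\<dots> \<le> 1 + ?e / ?d"
    using d assms by (intro add_left_mono divide_left_mono) auto
  also have "\<dots> \<le> exp (?e / ?d)"
    by (rule exp_ge_add_one_self)
  finally have "inverse (exp (?e / ?d)) \<le> inverse ((real p + real x + 1) / (real q - real x))"
    using d by (intro le_imp_inverse_le) auto
  then have step: "exp (- ?e / ?d) \<le> (real q - real x) / (real p + real x + 1)"
    by (simp only: minus_divide_left[symmetric] exp_minus inverse_divide)
  have "real ((p+q) choose p) * exp (- ((real (Suc x))\<^sup>2 + (real p - real q) * real (Suc x)) / ?d)
     = (real ((p+q) choose p) * exp (- ((real x)\<^sup>2 + (real p - real q) * real x) / ?d)) * exp (- ?e / ?d)"
    by (simp add: mult.assoc exp_add[symmetric] add_divide_distrib[symmetric] diff_divide_distrib[symmetric] power2_eq_square algebra_simps)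
  also have "\<dots> \<le> real ((p+q) choose (p+x)) * ((real q - real x) / (real p + real x + 1))"
    using Suc by (intro mult_mono step) auto
  also have "\<dots> = real ((p+q) choose (p + Suc x))"
    by (rule binomial_ratio_step[OF x, symmetric])
  finally show ?case .
qed simp

text \<open>
  Substituting \<open>x = u / s\<close> and \<open>n = 1 / s^2\<close> with \<open>s \<longlonglongrightarrow> 0\<close> and \<open>u \<longlonglongrightarrow> c\<close> turns both bounds for the
  quotient of binomial coefficients, and the quadratic factor, into continuous functions of \<open>(u, s)\<close>.
\<close>
lemma weight_tendsto:
  fixes x :: "nat \<Rightarrow> nat"
  assumes x: "(\<lambda>n. real (x n) / sqrt (real n)) \<longlonglongrightarrow> c"
  shows "(\<lambda>n. weight k n (x n)) \<longlonglongrightarrow> exp (- c\<^sup>2) * (4 * c\<^sup>2 - 2)"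
proof -
  define u where "u n = real (x n) / sqrt (real n)" for n
  define s where "s n = 1 / sqrt (real n)" for n
  have u: "u \<longlonglongrightarrow> c" using x by (simp add: u_def[abs_def])
  have s: "s \<longlonglongrightarrow> 0" unfolding s_def by real_asymp
  have us: "real (x n) = u n / s n" "real n = 1 / (s n)\<^sup>2" "s n > 0" if "n > 0" for n
    using that by (auto simp: u_def s_def power_divide)
  define C where "C n = real ((2*n-k+2) choose (n+1+x n)) / real ((2*n-k+2) choose (n+1))" for n
  have den: "(\<lambda>n. 1 + (1 - real k) * (s n)\<^sup>2 - u n * s n) \<longlonglongrightarrow> 1 + (1 - real k) * 0\<^sup>2 - c * 0"
    by (intro tendsto_intros u s)
  have "\<forall>\<^sub>F n in sequentially. 1 + (1 - real k) * (s n)\<^sup>2 - u n * s n > 0"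
    by (rule order_tendstoD(1)[OF den]) simp
  then have ev: "\<forall>\<^sub>F n in sequentially. n > 0 \<and> k \<le> n \<and> x n < n + 1 - k"
    using eventually_gt_at_top[of 0] eventually_ge_at_top[of k]
  proof eventually_elim
    case (elim n)
    have "real n + (1 - real k) - real (x n) = (1 + (1 - real k) * (s n)\<^sup>2 - u n * s n) / (s n)\<^sup>2"
      using us[OF elim(2)] by (simp add: field_simps power2_eq_square)
    also have "\<dots> > 0" using elim us(3)[OF elim(2)] by simp
    finally show ?case using elim by (simp add: of_nat_diff)
  qed
  have Clim: "C \<longlonglongrightarrow> exp (- c\<^sup>2)"
  proof (rule tendsto_sandwich)
    show "\<forall>\<^sub>F n in sequentially. C n \<le> exp (- ((u n)\<^sup>2 / (1 + (s n)\<^sup>2 + u n * s n)))"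
      using ev
    proof eventually_elim
      case (elim n)
      have e: "2*n-k+2 = (n+1) + (n+1-k)" using elim by auto
      have "C n \<le> exp (- (real (x n))\<^sup>2 / (real (n+1) + real (x n)))"
        unfolding C_def e using binomial_ratio_upper[of "n+1-k" "n+1" "x n" "x n"]
        by (subst pos_divide_le_eq) (auto simp: mult.commute simp del: binomial_Suc_Suc)
      also have "- (real (x n))\<^sup>2 / (real (n+1) + real (x n)) = - ((u n)\<^sup>2 / (1 + (s n)\<^sup>2 + u n * s n))"
      proof -
        have sp: "s n > 0" using us elim by blast
        have "(real (x n))\<^sup>2 = (u n)\<^sup>2 / (s n)\<^sup>2"
          "real (n+1) + real (x n) = (1 + (s n)\<^sup>2 + u n * s n) / (s n)\<^sup>2"
          using us[of n] elim by (simp_all add: field_simps power2_eq_square)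
        then show ?thesis using sp by simp
      qed
      finally show ?case .
    qed
    show "\<forall>\<^sub>F n in sequentially. exp (- (((u n)\<^sup>2 + real k * u n * s n) / (1 + (1 - real k) * (s n)\<^sup>2 - u n * s n))) \<le> C n"
      using ev
    proof eventually_elim
      case (elim n)
      have e: "2*n-k+2 = (n+1) + (n+1-k)" using elim by auto
      have "exp (- ((real (x n))\<^sup>2 + (real (n+1) - real (n+1-k)) * real (x n)) / (real (n+1-k) - real (x n))) \<le> C n"
        unfolding C_def e using binomial_ratio_lower[of "n+1-k" "n+1" "x n" "x n"] elim
        by (subst pos_le_divide_eq) (auto simp: mult.commute simp del: binomial_Suc_Suc)
      also have "- ((real (x n))\<^sup>2 + (real (n+1) - real (n+1-k)) * real (x n)) / (real (n+1-k) - real (x n))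
         = - ((real (x n))\<^sup>2 + real k * real (x n)) / (real n + (1 - real k) - real (x n))"
        using elim by (simp add: of_nat_diff algebra_simps)
      also have "\<dots> = - (((u n)\<^sup>2 + real k * u n * s n) / (1 + (1 - real k) * (s n)\<^sup>2 - u n * s n))"
      proof -
        have sp: "s n > 0" using us elim by blast
        have "n > 0" using elim by simp
        then have "(real (x n))\<^sup>2 + real k * real (x n) = ((u n)\<^sup>2 + real k * u n * s n) / (s n)\<^sup>2"
          using sp by (simp only: us(1)) (simp add: field_simps power2_eq_square)
        moreover have "real n + (1 - real k) - real (x n) = (1 + (1 - real k) * (s n)\<^sup>2 - u n * s n) / (s n)\<^sup>2"
          using us[of n] elim by (simp add: field_simps power2_eq_square)
        ultimately show ?thesis using sp by (simp only: minus_divide_left[symmetric]) simp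
      qed
      finally show ?case .
    qed
    have "(\<lambda>n. exp (- ((u n)\<^sup>2 / (1 + (s n)\<^sup>2 + u n * s n)))) \<longlonglongrightarrow> exp (- (c\<^sup>2 / (1 + 0\<^sup>2 + c * 0)))"
      by (intro tendsto_intros u s) auto
    then show "(\<lambda>n. exp (- ((u n)\<^sup>2 / (1 + (s n)\<^sup>2 + u n * s n)))) \<longlonglongrightarrow> exp (- c\<^sup>2)" by simp
    have "(\<lambda>n. exp (- (((u n)\<^sup>2 + real k * u n * s n) / (1 + (1 - real k) * (s n)\<^sup>2 - u n * s n))))
       \<longlonglongrightarrow> exp (- ((c\<^sup>2 + real k * c * 0) / (1 + (1 - real k) * 0\<^sup>2 - c * 0)))"
      by (intro tendsto_intros u s) auto
    then show "(\<lambda>n. exp (- (((u n)\<^sup>2 + real k * u n * s n) / (1 + (1 - real k) * (s n)\<^sup>2 - u n * s n))))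
       \<longlonglongrightarrow> exp (- c\<^sup>2)" by simp
  qed
  define R where "R n = ((2 * u n + real k * s n)\<^sup>2 - 2 + (real k - 2) * (s n)\<^sup>2) / (1 + (1 - real k) * (s n)\<^sup>2)" for n
  have "R \<longlonglongrightarrow> ((2 * c + real k * 0)\<^sup>2 - 2 + (real k - 2) * 0\<^sup>2) / (1 + (1 - real k) * 0\<^sup>2)"
    unfolding R_def by (intro tendsto_intros u s) auto
  then have R: "R \<longlonglongrightarrow> 4 * c\<^sup>2 - 2" by (simp add: power_mult_distrib)
  have "(\<lambda>n. C n * R n) \<longlonglongrightarrow> exp (- c\<^sup>2) * (4 * c\<^sup>2 - 2)"
    by (intro tendsto_intros Clim R)
  moreover have "\<forall>\<^sub>F n in sequentially. C n * R n = weight k n (x n)"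
    using ev
  proof eventually_elim
    case (elim n)
    have sp: "s n > 0" using us elim by blast
    have n: "n > 0" using elim by simp
    have c: "real (2*n-k+2) = 2 * real n - real k + 2" using elim by (simp add: of_nat_diff)
    have "(2 * real (x n) + real k)\<^sup>2 - real (2*n-k+2) = ((2 * u n + real k * s n)\<^sup>2 - 2 + (real k - 2) * (s n)\<^sup>2) / (s n)\<^sup>2"
      unfolding c us(1)[OF n] us(2)[OF n] using sp by (simp add: field_simps power2_eq_square)
    moreover have "real (n+1-k) = (1 + (1 - real k) * (s n)\<^sup>2) / (s n)\<^sup>2"
      using us[of n] elim by (simp add: of_nat_diff field_simps power2_eq_square)
    ultimately have "R n = ((2 * real (x n) + real k)\<^sup>2 - real (2*n-k+2)) / real (n+1-k)"
      using sp by (simp add: R_def)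
    then show ?case by (simp add: weight_def C_def)
  qed
  ultimately show ?thesis by (rule Lim_transform_eventually)
qed

lemma weight_eq_0:
  assumes "k \<le> n" "n + 1 < x"
  shows "weight k n x = 0"
  using assms by (simp add: weight_def binomial_eq_0 del: binomial_Suc_Suc)

lemma exp_minus_le:
  fixes u :: real
  assumes "u > 0"
  shows "exp (- u) * (36 * u + 4) \<le> 76 / u"
proof -
  have e: "1 + u + u\<^sup>2 / 2 \<le> exp u" using exp_lower_Taylor_quadratic[of u] assms by simp
  have "u * (36 * u + 4) \<le> 76 * (1 + u + u\<^sup>2 / 2)"
    using assms by (simp add: algebra_simps power2_eq_square)
  also have "\<dots> \<le> 76 * exp u" using e by simp
  finally show ?thesis using assms by (simp add: exp_minus field_simps)
qed

text \<open>
  The Gaussian factor is \<open>exp (- u)\<close> with \<open>u = x^2 / (2 * (n + 1))\<close> and the quadratic factor is linear in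
  \<open>u\<close>, so their product decays faster than \<open>1 / u\<close>. Decay of the order \<open>1 / u\<close> is enough, because it is
  summable along the multiples of \<open>m\<close> and integrable in \<open>m / sqrt n\<close>.
\<close>
lemma weight_bound:
  assumes "2 * k \<le> n" "0 < x" "k \<le> x"
  shows "\<bar>weight k n x\<bar> \<le> 152 * real (n + 1) / (real x)\<^sup>2"
proof (cases "n + 1 < x")
  case True
  then show ?thesis using assms weight_eq_0[of k n x] by simp
next
  case False
  define u where "u = (real x)\<^sup>2 / (2 * real (n + 1))"
  have u: "u > 0" using assms by (simp add: u_def)
  have e: "2*n-k+2 = (n+1) + (n+1-k)" using assms by simp
  define C where "C = real ((2*n-k+2) choose (n+1+x)) / real ((2*n-k+2) choose (n+1))"
  have C: "0 \<le> C" by (simp add: C_def)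
  have "C \<le> exp (- (real x)\<^sup>2 / (real (n+1) + real (n+1)))"
    unfolding C_def e using binomial_ratio_upper[of "n+1-k" "n+1" x "n+1"] False
    by (subst pos_divide_le_eq) (auto simp: mult.commute simp del: binomial_Suc_Suc)
  also have "\<dots> = exp (- u)" by (simp add: u_def)
  finally have C2: "C \<le> exp (- u)" .
  have "\<bar>(2 * real x + real k)\<^sup>2 - real (2*n-k+2)\<bar> \<le> (3 * real x)\<^sup>2 + 2 * real (n + 1)"
  proof -
    have "(2 * real x + real k)\<^sup>2 \<le> (3 * real x)\<^sup>2"
      using assms by (intro power_mono) auto
    moreover have "0 \<le> (2 * real x + real k)\<^sup>2" by simp
    moreover have "real (2*n-k+2) \<le> 2 * real (n + 1)" by simp
    moreover have "0 \<le> (3 * real x)\<^sup>2" "0 \<le> real (2*n-k+2)" "0 \<le> real (n + 1)" by simp_all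
    ultimately show ?thesis by linarith
  qed
  then have "\<bar>(2 * real x + real k)\<^sup>2 - real (2*n-k+2)\<bar> / real (n+1-k) \<le>
     ((3 * real x)\<^sup>2 + 2 * real (n + 1)) / (real (n + 1) / 2)"
    using assms by (intro frac_le) (auto simp: of_nat_diff)
  also have "\<dots> = 36 * u + 4"
    by (simp add: u_def field_simps)
  finally have "\<bar>weight k n x\<bar> \<le> exp (- u) * (36 * u + 4)"
    unfolding weight_def C_def[symmetric] using C C2
    by (simp add: abs_mult abs_divide del: times_divide_eq_right add: times_divide_eq_right[symmetric])
       (intro mult_mono, auto)
  also have "\<dots> \<le> 76 / u" by (rule exp_minus_le[OF u])
  also have "\<dots> = 152 * real (n + 1) / (real x)\<^sup>2" by (simp add: u_def)
  finally show ?thesis .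
qed

text \<open>
  The condition \<open>2 * k \<le> h\<close> ensures that the shift by \<open>l\<close> loses at most a factor \<open>2\<close>.
\<close>
lemma weight_multiple_bound:
  assumes "2 * k \<le> n" "0 < n" "2 * k \<le> h" "l \<le> k" "0 < t" "t * sqrt (real n) \<le> real h + 1"
  shows "\<bar>weight k n ((h + 3) * Suc j - l)\<bar> \<le> 1216 / t\<^sup>2 * (1 / (real (Suc j))\<^sup>2)"
proof -
  define x where "x = (h + 3) * Suc j - l"
  have hm: "h + 3 \<le> (h + 3) * Suc j" by simp
  have x: "0 < x" "k \<le> x" using hm assms unfolding x_def by linarith+
  have "(h + 3) * Suc j \<le> 2 * x" using hm assms unfolding x_def by linarith
  then have "real ((h + 3) * Suc j) \<le> real (2 * x)" by (simp only: of_nat_le_iff)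
  then have "real ((h + 3) * Suc j) \<le> 2 * real x" by (simp only: of_nat_mult of_nat_numeral)
  moreover have "t * sqrt (real n) * real (Suc j) \<le> real ((h + 3) * Suc j)"
    using assms by (simp only: of_nat_mult) (intro mult_right_mono, auto)
  ultimately have "t * sqrt (real n) * real (Suc j) / 2 \<le> real x" by linarith
  then have "(t * sqrt (real n) * real (Suc j) / 2)\<^sup>2 \<le> (real x)\<^sup>2"
    using assms by (intro power_mono) auto
  then have x2: "t\<^sup>2 * real n * (real (Suc j))\<^sup>2 / 4 \<le> (real x)\<^sup>2"
    by (simp add: power_mult_distrib power_divide del: of_nat_Suc)
  have "\<bar>weight k n x\<bar> \<le> 152 * real (n + 1) / (real x)\<^sup>2"
    using assms x by (intro weight_bound) auto
  also have "\<dots> \<le> (304 * real n) / (t\<^sup>2 * real n * (real (Suc j))\<^sup>2 / 4)"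
    using assms x2 by (intro frac_le) (auto simp del: of_nat_Suc)
  also have "\<dots> = 1216 / t\<^sup>2 * (1 / (real (Suc j))\<^sup>2)"
    using assms by (simp add: field_simps del: of_nat_Suc)
  finally show ?thesis unfolding x_def .
qed

section \<open>The limiting tail and its integral\<close>

definition tail_term :: "nat \<Rightarrow> real \<Rightarrow> real" where
  "tail_term j t = exp (- (real (Suc j) * t)\<^sup>2) * (4 * (real (Suc j) * t)\<^sup>2 - 2)"

definition limit_tail :: "real \<Rightarrow> real" where
  "limit_tail t = (\<Sum>j. tail_term j t)"

lemma summable_inverse_squares: "summable (\<lambda>j. 1 / (real (Suc j))\<^sup>2)"
  using inverse_squares_sums by (simp add: sums_iff add.commute)

lemma abs_tail_term_le:
  assumes "0 < a" "a \<le> t"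
  shows "\<bar>tail_term j t\<bar> \<le> 76 / a\<^sup>2 * (1 / (real (Suc j))\<^sup>2)"
proof -
  define u where "u = (real (Suc j) * t)\<^sup>2"
  have u: "u > 0" using assms by (simp add: u_def)
  have "\<bar>tail_term j t\<bar> = exp (- u) * \<bar>4 * u - 2\<bar>"
    by (simp add: tail_term_def u_def abs_mult)
  also have "\<dots> \<le> exp (- u) * (36 * u + 4)"
    using u by (intro mult_left_mono) auto
  also have "\<dots> \<le> 76 / u" by (rule exp_minus_le[OF u])
  also have "\<dots> \<le> 76 / ((real (Suc j) * a)\<^sup>2)"
    unfolding u_def using assms by (intro divide_left_mono power_mono mult_left_mono) auto
  also have "\<dots> = 76 / a\<^sup>2 * (1 / (real (Suc j))\<^sup>2)"
    by (simp add: power_mult_distrib del: of_nat_Suc)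
  finally show ?thesis .
qed

lemma tail_terms_converge_uniformly:
  assumes "0 < a"
  shows "uniform_limit {a..} (\<lambda>n t. \<Sum>j<n. tail_term j t) limit_tail sequentially"
  unfolding limit_tail_def[abs_def]
proof (rule Weierstrass_m_test)
  show "norm (tail_term j t) \<le> 76 / a\<^sup>2 * (1 / (real (Suc j))\<^sup>2)" if "t \<in> {a..}" for j t
    using abs_tail_term_le[of a t j] assms that by simp
  show "summable (\<lambda>j. 76 / a\<^sup>2 * (1 / (real (Suc j))\<^sup>2))"
    by (intro summable_mult summable_inverse_squares)
qed

lemma isCont_limit_tail:
  assumes "0 < t"
  shows "isCont limit_tail t"
proof -
  have "continuous_on {t/2..} limit_tail"
  proof (rule uniform_limit_theorem[OF _ tail_terms_converge_uniformly])
    show "\<forall>\<^sub>F n in sequentially. continuous_on {t/2..} (\<lambda>t. \<Sum>j<n. tail_term j t)"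
      unfolding tail_term_def by (intro always_eventually allI continuous_intros)
  qed (use assms in auto)
  moreover have "t \<in> interior {t/2..}" using assms by simp
  ultimately show ?thesis by (rule continuous_on_interior)
qed

definition gauss_sum :: "real \<Rightarrow> real" where
  "gauss_sum t = (\<Sum>j. exp (- (real (Suc j) * t)\<^sup>2))"

lemma exp_minus_square_le:
  assumes "t > 0"
  shows "exp (- (real (Suc j) * t)\<^sup>2) \<le> 1 / t\<^sup>2 * (1 / (real (Suc j))\<^sup>2)"
proof -
  let ?u = "(real (Suc j) * t)\<^sup>2"
  have u: "?u > 0" using assms by simp
  have "?u \<le> exp ?u" using exp_ge_add_one_self[of ?u] by linarith
  then have "exp (- ?u) \<le> 1 / ?u"
    using u by (simp add: exp_minus field_simps del: of_nat_Suc)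
  also have "\<dots> = 1 / t\<^sup>2 * (1 / (real (Suc j))\<^sup>2)"
    by (simp add: power_mult_distrib del: of_nat_Suc)
  finally show ?thesis .
qed

lemma summable_gauss:
  assumes "t > 0"
  shows "summable (\<lambda>j. exp (- (real (Suc j) * t)\<^sup>2))"
  by (rule summable_comparison_test'[OF summable_mult[OF summable_inverse_squares, of "1/t\<^sup>2"], of 0])
     (use exp_minus_square_le[OF assms] in simp)

lemma DERIV_gauss_sum:
  assumes "0 < t"
  shows "((\<lambda>t. - 2 * t * gauss_sum t) has_real_derivative limit_tail t) (at t)"
proof -
  let ?g = "\<lambda>j t. - 2 * t * exp (- (real (Suc j) * t)\<^sup>2)"
  have deriv: "((\<lambda>t. \<Sum>j. ?g j t) has_real_derivative (\<Sum>j. tail_term j t)) (at t)"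
  proof (rule has_field_derivative_series'(2))
    show "(?g j has_real_derivative tail_term j x) (at x within {t/2..})" for j x
      unfolding tail_term_def
      by (auto intro!: derivative_eq_intros simp: power2_eq_square algebra_simps simp del: of_nat_Suc)
    show "uniformly_convergent_on {t/2..} (\<lambda>n t. \<Sum>j<n. tail_term j t)"
      using tail_terms_converge_uniformly[of "t/2"] assms by (auto simp: uniformly_convergent_on_def)
    show "t \<in> {t/2..}" "t \<in> interior {t/2..}" using assms by auto
    show "summable (\<lambda>j. ?g j t)" by (intro summable_mult summable_gauss assms)
  qed auto
  have "(\<Sum>j. ?g j x) = - 2 * x * gauss_sum x" if "x > 0" for x
    using suminf_mult[OF summable_gauss[OF that], of "- 2 * x"] by (simp only: gauss_sum_def)
  then have ev: "\<forall>\<^sub>F x in nhds t. (\<Sum>j. ?g j x) = - 2 * x * gauss_sum x"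
    using eventually_nhds_in_open[of "{0<..}" t] assms by (auto elim!: eventually_mono)
  show ?thesis
    unfolding limit_tail_def by (rule DERIV_cong_ev[OF refl ev refl, THEN iffD1, OF deriv])
qed

lemma gauss_integral_step:
  fixes a b :: real
  assumes "0 \<le> a" "a \<le> b"
  shows "(b - a) * exp (- b\<^sup>2) \<le> integral {0..b} (\<lambda>u. exp (- u\<^sup>2)) - integral {0..a} (\<lambda>u. exp (- u\<^sup>2))"
    and "integral {0..b} (\<lambda>u. exp (- u\<^sup>2)) - integral {0..a} (\<lambda>u. exp (- u\<^sup>2)) \<le> (b - a) * exp (- a\<^sup>2)"
proof -
  have int: "(\<lambda>u::real. exp (- u\<^sup>2)) integrable_on {x..y}" for x y
    by (intro integrable_continuous_real continuous_intros)
  have eq: "integral {0..b} (\<lambda>u. exp (- u\<^sup>2)) - integral {0..a} (\<lambda>u. exp (- u\<^sup>2)) = integral {a..b} (\<lambda>u. exp (- u\<^sup>2))"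
    using Henstock_Kurzweil_Integration.integral_combine[OF assms int] by simp
  have "integral {a..b} (\<lambda>u. exp (- b\<^sup>2)) \<le> integral {a..b} (\<lambda>u. exp (- u\<^sup>2))"
    using assms by (intro integral_le int) (auto intro!: power_mono)
  then show "(b - a) * exp (- b\<^sup>2) \<le> integral {0..b} (\<lambda>u. exp (- u\<^sup>2)) - integral {0..a} (\<lambda>u. exp (- u\<^sup>2))"
    using assms unfolding eq by simp
  have "integral {a..b} (\<lambda>u. exp (- u\<^sup>2)) \<le> integral {a..b} (\<lambda>u. exp (- a\<^sup>2))"
    using assms by (intro integral_le int) (auto intro!: power_mono)
  then show "integral {0..b} (\<lambda>u. exp (- u\<^sup>2)) - integral {0..a} (\<lambda>u. exp (- u\<^sup>2)) \<le> (b - a) * exp (- a\<^sup>2)"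
    using assms unfolding eq by simp
qed

lemma gauss_integral_tendsto:
  "((\<lambda>y. integral {0..y} (\<lambda>u. exp (- u\<^sup>2))) \<longlongrightarrow> sqrt pi / 2) at_top"
proof -
  let ?f = "\<lambda>x::real. indicator {0..} x *\<^sub>R exp (- x\<^sup>2)"
  have "((\<lambda>y. \<integral>x. indicator {..y} x *\<^sub>R ?f x \<partial>lborel) \<longlongrightarrow> (\<integral>x. ?f x \<partial>lborel)) at_top"
    using gaussian_moment_0 by (intro tendsto_integral_at_top) (auto simp: has_bochner_integral_iff)
  moreover have "(\<integral>x. ?f x \<partial>lborel) = sqrt pi / 2"
    using gaussian_moment_0 by (simp add: has_bochner_integral_iff)
  moreover have "(\<integral>x. indicator {..y} x *\<^sub>R ?f x \<partial>lborel) = integral {0..y} (\<lambda>u. exp (- u\<^sup>2))" for y :: real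
  proof -
    have "(\<integral>x. indicator {..y} x *\<^sub>R ?f x \<partial>lborel) = (LINT x:{0..y}|lborel. exp (- x\<^sup>2))"
      unfolding set_lebesgue_integral_def
      by (intro Bochner_Integration.integral_cong) (auto split: split_indicator)
    also have "\<dots> = integral {0..y} (\<lambda>u. exp (- u\<^sup>2))"
      by (intro set_borel_integral_eq_integral(2) borel_integrable_atLeastAtMost') (intro continuous_intros)
    finally show ?thesis .
  qed
  ultimately show ?thesis by (simp only:)
qed

text \<open>
  Comparison of the Riemann sum \<open>e * gauss_sum e\<close> with the integral of the decreasing function
  \<open>exp (- u^2)\<close>; the missing left end point of the sum costs at most \<open>e\<close>.
\<close>
lemma gauss_sum_bounds:
  assumes "e > 0"
  shows "e * gauss_sum e \<le> sqrt pi / 2" "sqrt pi / 2 - e \<le> e * gauss_sum e"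
proof -
  define E where "E y = integral {0..y} (\<lambda>u. exp (- u\<^sup>2))" for y :: real
  have E: "(b - a) * exp (- b\<^sup>2) \<le> E b - E a" "E b - E a \<le> (b - a) * exp (- a\<^sup>2)"
    if "0 \<le> a" "a \<le> b" for a b
    using gauss_integral_step[OF that] by (simp_all add: E_def)
  have E0: "E 0 = 0" by (simp add: E_def)
  have lim: "(\<lambda>J. E (real (Suc J) * e)) \<longlonglongrightarrow> sqrt pi / 2"
    unfolding E_def using assms
    by (intro filterlim_compose[OF gauss_integral_tendsto] filterlim_tendsto_pos_mult_at_top[of _ e]
        filterlim_at_top_mult_tendsto_pos[of _ e] tendsto_const
        filterlim_compose[OF filterlim_real_sequentially filterlim_Suc])
  have up: "e * (\<Sum>j<J. exp (- (real (Suc j) * e)\<^sup>2)) \<le> E (real J * e)" for J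
  proof (induction J)
    case (Suc J)
    have "e * exp (- (real (Suc J) * e)\<^sup>2) \<le> E (real (Suc J) * e) - E (real J * e)"
      using E(1)[of "real J * e" "real (Suc J) * e"] assms by (simp add: algebra_simps)
    with Suc show ?case by (simp add: distrib_left del: of_nat_Suc)
  qed (simp add: E0)
  have down: "E (real (Suc J) * e) - e \<le> e * (\<Sum>j<J. exp (- (real (Suc j) * e)\<^sup>2))" for J
  proof (induction J)
    case 0
    then show ?case using E(2)[of 0 e] assms E0 by simp
  next
    case (Suc J)
    have "E (real (Suc (Suc J)) * e) - E (real (Suc J) * e) \<le> e * exp (- (real (Suc J) * e)\<^sup>2)"
      using E(2)[of "real (Suc J) * e" "real (Suc (Suc J)) * e"] assms by (simp add: algebra_simps)
    with Suc show ?case by (simp add: distrib_left del: of_nat_Suc)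
  qed
  have sums: "(\<lambda>J. e * (\<Sum>j<J. exp (- (real (Suc j) * e)\<^sup>2))) \<longlonglongrightarrow> e * gauss_sum e"
    unfolding gauss_sum_def by (intro tendsto_mult tendsto_const summable_LIMSEQ summable_gauss assms)
  show "sqrt pi / 2 - e \<le> e * gauss_sum e"
    by (rule tendsto_le[OF sequentially_bot sums tendsto_diff[OF lim tendsto_const]])
       (intro always_eventually allI down)
  have "E (real J * e) \<le> E (real (Suc J) * e)" for J
    using E(1)[of "real J * e" "real (Suc J) * e"] assms
    by (smt (verit) exp_gt_zero mult_nonneg_nonneg mult_right_mono of_nat_0_le_iff of_nat_Suc)
  then show "e * gauss_sum e \<le> sqrt pi / 2"
    using order_trans[OF up] by (intro tendsto_le[OF _ lim sums]) (auto intro!: always_eventually)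
qed

text \<open>
  Nonnegativity, which is far from obvious from the series, replaces a proof of integrability near \<open>0\<close>
  in the fundamental theorem of calculus. It is supplied by \<open>limit_tail_nonneg\<close>, because the function is a
  limit of probabilities.
\<close>
lemma limit_tail_integral:
  assumes "\<And>t. t > 0 \<Longrightarrow> limit_tail t \<ge> 0"
  shows "set_integrable lborel {0<..} limit_tail" "(LINT t:{0<..}|lborel. limit_tail t) = sqrt pi"
proof -
  let ?G = "\<lambda>t. - 2 * t * gauss_sum t"
  have 0: "(?G \<longlongrightarrow> - sqrt pi) (at_right 0)"
  proof (rule tendsto_sandwich)
    show "\<forall>\<^sub>F t in at_right 0. - sqrt pi \<le> ?G t"
      using eventually_at_right_less[of "0::real"]
      by eventually_elim (use gauss_sum_bounds(1) in force)
    show "\<forall>\<^sub>F t in at_right 0. ?G t \<le> - sqrt pi + 2 * t"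
      using eventually_at_right_less[of "0::real"]
      by eventually_elim (use gauss_sum_bounds(2) in force)
    show "((\<lambda>t. - sqrt pi + 2 * t) \<longlongrightarrow> - sqrt pi) (at_right 0)"
      by (auto intro!: tendsto_eq_intros)
  qed simp
  define K where "K = (\<Sum>j. 1 / (real (Suc j))\<^sup>2)"
  have inf: "(?G \<longlongrightarrow> 0) at_top"
  proof (rule Lim_null_comparison)
    show "\<forall>\<^sub>F t in at_top. norm (?G t) \<le> 2 * K / t"
      using eventually_gt_at_top[of "0::real"]
    proof eventually_elim
      case (elim t)
      have "gauss_sum t \<le> 1 / t\<^sup>2 * K"
        unfolding gauss_sum_def K_def suminf_mult[OF summable_inverse_squares, symmetric]
        by (intro suminf_le exp_minus_square_le elim summable_gauss summable_mult summable_inverse_squares)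
      moreover have "0 \<le> gauss_sum t"
        unfolding gauss_sum_def by (intro suminf_nonneg summable_gauss elim) auto
      ultimately have "2 * t * gauss_sum t \<le> 2 * t * (1 / t\<^sup>2 * K)" "0 \<le> 2 * t * gauss_sum t"
        using elim by (intro mult_left_mono mult_nonneg_nonneg; simp)+
      then show ?case using elim by (simp add: power2_eq_square)
    qed
    show "((\<lambda>t. 2 * K / t) \<longlongrightarrow> 0) at_top" by real_asymp
  qed
  have A: "((?G \<circ> real_of_ereal) \<longlongrightarrow> - sqrt pi) (at_right (0::ereal))"
    using 0 by (simp add: zero_ereal_def ereal_tendsto_simps)
  have B: "((?G \<circ> real_of_ereal) \<longlongrightarrow> 0) (at_left \<infinity>)"
    using inf by (simp add: ereal_tendsto_simps)
  have ei: "einterval 0 \<infinity> = {0::real<..}"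
    by (auto simp: einterval_def)
  have G: "(?G has_real_derivative limit_tail t) (at t)" if "0 < ereal t" for t
    using that by (intro DERIV_gauss_sum) simp
  have F: "isCont limit_tail t" if "0 < ereal t" for t
    using that by (intro isCont_limit_tail) simp
  have nonneg: "AE t in lborel. 0 < ereal t \<longrightarrow> ereal t < \<infinity> \<longrightarrow> 0 \<le> limit_tail t"
    using assms by simp
  note FTC = interval_integral_FTC_nonneg[of 0 \<infinity> ?G limit_tail, OF _ G F nonneg A B]
  have "set_integrable lborel (einterval 0 \<infinity>) limit_tail"
    by (rule FTC(1)) simp
  then show "set_integrable lborel {0<..} limit_tail" by (simp add: ei)
  have "(LBINT x=0..\<infinity>. limit_tail x) = 0 - - sqrt pi"
    by (rule FTC(2)) simp
  then show "(LINT t:{0<..}|lborel. limit_tail t) = sqrt pi"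
    by (simp add: interval_lebesgue_integral_0_infty)
qed

section \<open>Convergence of the tail and of the average\<close>

lemma height_tail_bounds: "0 \<le> height_tail k n h" "height_tail k n h \<le> 1"
proof -
  have "card {p \<in> partial_luka_rl n k. int h < path_height p} \<le> card (partial_luka_rl n k)"
    by (intro card_mono finite_partial_luka_rl) auto
  then show "height_tail k n h \<le> 1"
    by (cases "card (partial_luka_rl n k) = 0") (auto simp: height_tail_def divide_le_eq_1)
qed (simp add: height_tail_def)

lemma height_tail_suminf:
  assumes "k < n" "k \<le> h"
  shows "height_tail k n h = (\<Sum>l\<le>k. \<Sum>j. weight k n ((h + 3) * Suc j - l)) / real (k + 1)"
proof -
  have "(\<Sum>j=1..2*n. weight k n ((h + 3) * j - l)) = (\<Sum>j. weight k n ((h + 3) * Suc j - l))"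
    if "l \<le> k" for l
  proof -
    have "weight k n ((h + 3) * Suc j - l) = 0" if j: "j \<notin> {..<2*n}" for j
    proof (rule weight_eq_0)
      have "h \<le> h * Suc j" by simp
      moreover have "(h + 3) * Suc j = h * Suc j + 3 * Suc j" by (simp only: distrib_right)
      ultimately show "n + 1 < (h + 3) * Suc j - l" using assms \<open>l \<le> k\<close> j by simp
    qed (use assms in simp)
    then have "(\<Sum>j. weight k n ((h + 3) * Suc j - l)) = (\<Sum>j<2*n. weight k n ((h + 3) * Suc j - l))"
      by (intro suminf_finite) auto
    also have "\<dots> = (\<Sum>j=1..2*n. weight k n ((h + 3) * j - l))"
      by (simp only: One_nat_def sum.atLeast1_atMost_eq)
    finally show ?thesis by simp
  qed
  then show ?thesis
    using height_tail_eq[OF assms order.refl] by simp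
qed

lemma height_tail_decay:
  assumes "2 * k \<le> n" "k < n" "2 * k \<le> h" "0 < t" "t * sqrt (real n) \<le> real h + 1"
  shows "height_tail k n h \<le> 1216 * (\<Sum>j. 1 / (real (Suc j))\<^sup>2) / t\<^sup>2"
proof -
  let ?S = "\<Sum>j. 1 / (real (Suc j))\<^sup>2"
  have "(\<Sum>j. weight k n ((h + 3) * Suc j - l)) \<le> 1216 / t\<^sup>2 * ?S" if "l \<le> k" for l
  proof -
    have b: "\<bar>weight k n ((h + 3) * Suc j - l)\<bar> \<le> 1216 / t\<^sup>2 * (1 / (real (Suc j))\<^sup>2)" for j
      using assms that by (intro weight_multiple_bound) auto
    have sm: "summable (\<lambda>j. 1216 / t\<^sup>2 * (1 / (real (Suc j))\<^sup>2))"
      by (intro summable_mult summable_inverse_squares)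
    have "summable (\<lambda>j. weight k n ((h + 3) * Suc j - l))"
      by (rule summable_comparison_test'[OF sm, of 0]) (use b in simp)
    then have "(\<Sum>j. weight k n ((h + 3) * Suc j - l)) \<le> (\<Sum>j. 1216 / t\<^sup>2 * (1 / (real (Suc j))\<^sup>2))"
      using b by (intro suminf_le sm) (auto simp: abs_le_iff)
    also have "\<dots> = 1216 / t\<^sup>2 * ?S"
      by (rule suminf_mult[OF summable_inverse_squares])
    finally show ?thesis .
  qed
  then have "(\<Sum>l\<le>k. \<Sum>j. weight k n ((h + 3) * Suc j - l)) \<le> (\<Sum>l\<le>k. 1216 / t\<^sup>2 * ?S)"
    by (intro sum_mono) auto
  moreover have "k \<le> h" using assms(3) by simp
  ultimately have "height_tail k n h \<le> (\<Sum>l\<le>k. 1216 / t\<^sup>2 * ?S) / real (k + 1)"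
    unfolding height_tail_suminf[OF assms(2) \<open>k \<le> h\<close>] by (intro divide_right_mono) auto
  also have "\<dots> = 1216 / t\<^sup>2 * ?S"
  proof -
    have "(\<Sum>l\<le>k. c) / real (k + 1) = c" for c :: real by (simp add: field_simps)
    then show ?thesis .
  qed
  also have "\<dots> = 1216 * ?S / t\<^sup>2" by simp
  finally show ?thesis .
qed

lemma scaled_floor_tendsto:
  assumes "t > 0"
  shows "(\<lambda>n. real (nat \<lfloor>t * sqrt (real n)\<rfloor>) / sqrt (real n)) \<longlonglongrightarrow> t"
proof (rule tendsto_sandwich)
  show "\<forall>\<^sub>F n in sequentially. t - 1 / sqrt (real n) \<le> real (nat \<lfloor>t * sqrt (real n)\<rfloor>) / sqrt (real n)"
    using eventually_gt_at_top[of 0]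
  proof eventually_elim
    case (elim n)
    have "t - 1 / sqrt (real n) = (t * sqrt (real n) - 1) / sqrt (real n)"
      using elim by (simp add: diff_divide_distrib)
    also have "\<dots> \<le> real (nat \<lfloor>t * sqrt (real n)\<rfloor>) / sqrt (real n)"
      by (intro divide_right_mono, linarith, simp)
    finally show ?case .
  qed
  show "\<forall>\<^sub>F n in sequentially. real (nat \<lfloor>t * sqrt (real n)\<rfloor>) / sqrt (real n) \<le> t"
    using eventually_gt_at_top[of 0]
  proof eventually_elim
    case (elim n)
    have "real (nat \<lfloor>t * sqrt (real n)\<rfloor>) \<le> t * sqrt (real n)" using assms by simp
    then show ?case using elim by (simp add: field_simps)
  qed
  show "(\<lambda>n. t - 1 / sqrt (real n)) \<longlonglongrightarrow> t" by real_asymp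
qed auto

text \<open>
  The shift by \<open>l\<close> disappears on the scale \<open>sqrt n\<close>, so the \<open>k + 1\<close> inner series have the same limit. This
  is why the answer does not depend on \<open>k\<close>.
\<close>
lemma height_tail_tendsto:
  assumes t: "t > 0"
  shows "(\<lambda>n. height_tail k n (nat \<lfloor>t * sqrt (real n)\<rfloor>)) \<longlonglongrightarrow> limit_tail t"
proof -
  define h where "h n = nat \<lfloor>t * sqrt (real n)\<rfloor>" for n
  have h: "t * sqrt (real n) \<le> real (h n) + 1" for n unfolding h_def by linarith
  have "filterlim (\<lambda>n. t * sqrt (real n)) at_top sequentially"
    using t by real_asymp
  then have "\<forall>\<^sub>F n in sequentially. real (2 * k) + 1 \<le> t * sqrt (real n)"
    by (auto simp: filterlim_at_top)
  then have ev: "\<forall>\<^sub>F n in sequentially. 2 * k \<le> n \<and> k < n \<and> 2 * k \<le> h n"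
    using eventually_ge_at_top[of "2*k"] eventually_gt_at_top[of k]
  proof eventually_elim
    case (elim n)
    then show ?case using h[of n] by auto
  qed
  have "(\<lambda>n. \<Sum>j. weight k n ((h n + 3) * Suc j - l)) \<longlonglongrightarrow> (\<Sum>j. tail_term j t)" if "l \<le> k" for l
  proof -
    define M where "M j = 1216 / t\<^sup>2 * (1 / (real (Suc j))\<^sup>2)" for j
    have "\<forall>\<^sub>F n in sequentially. \<forall>j. norm (weight k n ((h n + 3) * Suc j - l)) \<le> M j"
      using ev
    proof eventually_elim
      case (elim n)
      then show ?case
        using weight_multiple_bound[of k n "h n" l t] t h[of n] that by (auto simp: M_def)
    qed
    then have bound: "\<forall>\<^sub>F (j, n) in at_top \<times>\<^sub>F sequentially. norm (weight k n ((h n + 3) * Suc j - l)) \<le> M j"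
      unfolding eventually_prod_filter
      by (intro exI[of _ "\<lambda>_. True"] exI[of _ "\<lambda>n. \<forall>j. norm (weight k n ((h n + 3) * Suc j - l)) \<le> M j"]) auto
    have lim: "(\<lambda>n. weight k n ((h n + 3) * Suc j - l)) \<longlonglongrightarrow> tail_term j t" for j
    proof -
      have "(\<lambda>n. (real (h n) / sqrt (real n) + 3 / sqrt (real n)) * real (Suc j) - real l / sqrt (real n))
          \<longlonglongrightarrow> (t + 0) * real (Suc j) - 0"
        unfolding h_def
        by (intro tendsto_intros scaled_floor_tendsto t) real_asymp+
      moreover have "(real (h n) / sqrt (real n) + 3 / sqrt (real n)) * real (Suc j) - real l / sqrt (real n)
         = real ((h n + 3) * Suc j - l) / sqrt (real n)" if "2 * k \<le> n \<and> k < n \<and> 2 * k \<le> h n" for n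
      proof -
        have "h n + 3 \<le> (h n + 3) * Suc j" by simp
        with that \<open>l \<le> k\<close> have "l \<le> (h n + 3) * Suc j" by linarith
        then have "real ((h n + 3) * Suc j - l) = (real (h n) + 3) * real (Suc j) - real l"
          by (simp only: of_nat_diff of_nat_mult of_nat_add of_nat_numeral)
        then show ?thesis by (simp only: diff_divide_distrib add_divide_distrib[symmetric] times_divide_eq_left)
      qed
      then have "\<forall>\<^sub>F n in sequentially. (real (h n) / sqrt (real n) + 3 / sqrt (real n)) * real (Suc j) - real l / sqrt (real n)
         = real ((h n + 3) * Suc j - l) / sqrt (real n)"
        using ev by (auto elim: eventually_mono)
      ultimately have "(\<lambda>n. real ((h n + 3) * Suc j - l) / sqrt (real n)) \<longlonglongrightarrow> (t + 0) * real (Suc j) - 0"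
        by (rule Lim_transform_eventually)
      from weight_tendsto[OF this, of k] show ?thesis
        by (simp add: tail_term_def mult.commute del: of_nat_Suc)
    qed
    have "summable M" unfolding M_def by (intro summable_mult summable_inverse_squares)
    from tannerys_theorem[OF lim bound this] show ?thesis by simp
  qed
  then have "(\<lambda>n. (\<Sum>l\<le>k. \<Sum>j. weight k n ((h n + 3) * Suc j - l)) / real (k + 1)) \<longlonglongrightarrow>
     (\<Sum>l\<le>k. limit_tail t) / real (k + 1)"
    unfolding limit_tail_def by (intro tendsto_divide tendsto_sum tendsto_const) auto
  moreover have "(\<Sum>l\<le>k. limit_tail t) / real (k + 1) = limit_tail t" by (simp add: field_simps)
  moreover have "\<forall>\<^sub>F n in sequentially. (\<Sum>l\<le>k. \<Sum>j. weight k n ((h n + 3) * Suc j - l)) / real (k + 1)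
      = height_tail k n (h n)"
    using ev by eventually_elim (simp add: height_tail_suminf)
  ultimately have "(\<lambda>n. height_tail k n (h n)) \<longlonglongrightarrow> limit_tail t"
    using Lim_transform_eventually by force
  then show ?thesis by (simp only: h_def)
qed

lemma limit_tail_nonneg: "t > 0 \<Longrightarrow> limit_tail t \<ge> 0"
  by (rule tendsto_lowerbound[OF height_tail_tendsto[of t 0]]) (auto intro!: always_eventually height_tail_bounds)

lemma path_height_nonneg: "0 \<le> path_height p"
  using ordinate_le_path_height[of 0 p] by (simp add: ordinate_def)

text \<open>
  For an integer height \<open>H\<close> and \<open>t > 0\<close>, \<open>H\<close> exceeds the integer part of \<open>t * sqrt n\<close> exactly if
  \<open>t < H / sqrt n\<close>. The function is thus the mean of the indicators of the intervals from \<open>0\<close> to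
  \<open>H / sqrt n\<close>.
\<close>
lemma height_tail_integral:
  assumes "n > 0"
  shows "has_bochner_integral lborel (\<lambda>t. indicator {0<..} t * height_tail k n (nat \<lfloor>t * sqrt (real n)\<rfloor>))
     (average_height k n / sqrt (real n))"
proof -
  let ?P = "partial_luka_rl n k" and ?b = "\<lambda>p. real_of_int (path_height p) / sqrt (real n)"
  have s: "sqrt (real n) > 0" using assms by simp
  have fin: "finite ?P" by (rule finite_partial_luka_rl)
  have "has_bochner_integral lborel (indicator {0<..<?b p} :: real \<Rightarrow> real) (?b p)" for p
  proof -
    have "0 \<le> ?b p" using path_height_nonneg[of p] s by simp
    then show ?thesis
      using has_bochner_integral_real_indicator[of "{0<..<?b p}" lborel] by simp
  qed
  then have "has_bochner_integral lborel (\<lambda>t. (\<Sum>p\<in>?P. indicator {0<..<?b p} t) / real (card ?P)) ((\<Sum>p\<in>?P. ?b p) / real (card ?P))"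
    by (intro has_bochner_integral_divide_zero has_bochner_integral_sum)
  moreover have "(\<Sum>p\<in>?P. ?b p) / real (card ?P) = average_height k n / sqrt (real n)"
    by (simp add: average_height_def sum_divide_distrib[symmetric])
  moreover have "(\<Sum>p\<in>?P. indicator {0<..<?b p} t) / real (card ?P)
     = indicator {0<..} t * height_tail k n (nat \<lfloor>t * sqrt (real n)\<rfloor>)" for t :: real
  proof (cases "t > 0")
    case True
    have "int (nat \<lfloor>t * sqrt (real n)\<rfloor>) < path_height p \<longleftrightarrow> t < ?b p" for p
      using True s by (simp add: floor_less_iff pos_less_divide_eq)
    then have "{p \<in> ?P. int (nat \<lfloor>t * sqrt (real n)\<rfloor>) < path_height p} = {p \<in> ?P. t < ?b p}" by simp
    moreover have "(\<Sum>p\<in>?P. indicator {0<..<?b p} t) = real (card {p \<in> ?P. t < ?b p})"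
      using True fin by (simp add: indicator_def sum.If_cases Int_def)
    ultimately show ?thesis using True by (simp add: height_tail_def)
  qed simp
  ultimately show ?thesis by simp
qed

text \<open>
  Dominated convergence. Where the decay estimate does not apply, \<open>t * sqrt n < 2 * k\<close> and hence
  \<open>t < 2 * k\<close>, so that the probability times \<open>t^2\<close> is bounded there as well; this explains the last term
  of the constant \<open>C\<close>.
\<close>
lemma average_height_scaled_tendsto:
  "(\<lambda>n. average_height k n / sqrt (real n)) \<longlonglongrightarrow> sqrt pi"
proof -
  define P where "P n t = indicator {0<..} t * height_tail k n (nat \<lfloor>t * sqrt (real n)\<rfloor>)" for n and t :: real
  define K where "K = 1216 * (\<Sum>j. 1 / (real (Suc j))\<^sup>2)"
  define C where "C = 1 + K + (2 * real k)\<^sup>2"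
  have K: "K \<ge> 0" unfolding K_def
    by (intro mult_nonneg_nonneg suminf_nonneg summable_inverse_squares) auto
  have int: "has_bochner_integral lborel (P n) (average_height k n / sqrt (real n))" if "n > 0" for n
    using height_tail_integral[OF that] by (simp add: P_def[abs_def])
  let ?F = "\<lambda>t. indicator {0<..} t * limit_tail t"
  have Fint: "has_bochner_integral lborel ?F (sqrt pi)"
    using limit_tail_integral[OF limit_tail_nonneg]
    by (simp add: has_bochner_integral_iff set_integrable_def set_lebesgue_integral_def)
  have dom: "norm (P n t) \<le> C * inverse (1 + t\<^sup>2)" if n: "n \<ge> 2 * k + 1" for n t
  proof (cases "t > 0")
    case True
    let ?h = "nat \<lfloor>t * sqrt (real n)\<rfloor>"
    have p: "0 \<le> height_tail k n ?h" "height_tail k n ?h \<le> 1" by (rule height_tail_bounds)+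
    have "height_tail k n ?h * t\<^sup>2 \<le> K + (2 * real k)\<^sup>2"
    proof (cases "2 * k \<le> ?h")
      case h: True
      have "t * sqrt (real n) \<le> real ?h + 1" by linarith
      then have "height_tail k n ?h \<le> K / t\<^sup>2"
        unfolding K_def using True h n by (intro height_tail_decay) auto
      then have "height_tail k n ?h * t\<^sup>2 \<le> K" using True by (simp add: pos_le_divide_eq)
      then show ?thesis by (smt (verit) zero_le_power2)
    next
      case False
      have "1 \<le> sqrt (real n)" using n by simp
      then have "t \<le> t * sqrt (real n)" using True by simp
      also have "\<dots> \<le> 2 * real k" using False by linarith
      finally have "t\<^sup>2 \<le> (2 * real k)\<^sup>2" using True by (intro power_mono) auto
      moreover have "height_tail k n ?h * t\<^sup>2 \<le> 1 * t\<^sup>2" by (intro mult_right_mono p) auto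
      ultimately show ?thesis using K by linarith
    qed
    then have "height_tail k n ?h * (1 + t\<^sup>2) \<le> C"
      using p by (simp add: C_def distrib_left)
    moreover have "1 + t\<^sup>2 > 0" by (smt (verit) zero_le_power2)
    ultimately show ?thesis using True p by (simp add: P_def field_simps)
  next
    case False
    have "C \<ge> 0" using K by (simp add: C_def)
    then show ?thesis using False by (simp add: P_def)
  qed
  have "(\<lambda>n. integral\<^sup>L lborel (P (n + (2*k+1)))) \<longlonglongrightarrow> integral\<^sup>L lborel ?F"
  proof (rule integral_dominated_convergence)
    show "integrable lborel (\<lambda>t::real. C * inverse (1 + t\<^sup>2))"
      using integrable_inverse_1_plus_square
      by (intro integrable_mult_right) (simp add: set_integrable_def)
    show "AE t in lborel. (\<lambda>n. P (n + (2*k+1)) t) \<longlonglongrightarrow> ?F t"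
    proof (rule AE_I2)
      fix t :: real
      have "(\<lambda>n. P n t) \<longlonglongrightarrow> ?F t"
        unfolding P_def by (cases "t > 0") (auto intro!: height_tail_tendsto)
      then show "(\<lambda>n. P (n + (2*k+1)) t) \<longlonglongrightarrow> ?F t" by (rule LIMSEQ_ignore_initial_segment)
    qed
    show "AE t in lborel. norm (P (n + (2*k+1)) t) \<le> C * inverse (1 + t\<^sup>2)" for n
      by (intro AE_I2 dom) simp
    show "?F \<in> borel_measurable lborel" using Fint by (auto simp: has_bochner_integral_iff)
    show "P (n + (2*k+1)) \<in> borel_measurable lborel" for n
      using int[of "n + (2*k+1)"] by (auto simp: has_bochner_integral_iff)
  qed
  moreover have "integral\<^sup>L lborel ?F = sqrt pi"
    using Fint by (simp add: has_bochner_integral_iff)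
  moreover have "integral\<^sup>L lborel (P (n + (2*k+1))) = average_height k (n + (2*k+1)) / sqrt (real (n + (2*k+1)))" for n
    using int[of "n + (2*k+1)"] by (simp add: has_bochner_integral_iff)
  ultimately have "(\<lambda>n. average_height k (n + (2*k+1)) / sqrt (real (n + (2*k+1)))) \<longlonglongrightarrow> sqrt pi" by simp
  then show ?thesis by (rule LIMSEQ_offset)
qed

theorem mainTheorem9:
  fixes k :: nat
  shows "(\<lambda>n. average_height k n) \<sim>[sequentially] (\<lambda>n. sqrt (pi * real n))"
proof (rule asymp_equivI')
  have "(\<lambda>n. average_height k n / sqrt (real n) / sqrt pi) \<longlonglongrightarrow> sqrt pi / sqrt pi"
    by (intro tendsto_intros average_height_scaled_tendsto) simp
  then show "(\<lambda>n. average_height k n / sqrt (pi * real n)) \<longlonglongrightarrow> 1"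
    by (simp add: real_sqrt_mult mult.commute)
qed

end
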